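(* Let $0<p<1$ and let $\mathcal{M}=(M_k)_{k\ge0}$ be any sequence of real numbers $M_k\ge1$. Then there exists a canonical continuous embedding (injective continuous linear map) $$L^p(\mathbb{R})\hookrightarrow\widehat{\mathcal{C}},$$ where $\widehat{\mathcal{C}}$ is the abstract completion of $\mathcal{C}$ with respect to $\|\cdot\|_{\mathcal{M}}$. Explicitly, one can map $f\in L^p(\mathbb{R})$ to (the class of) a Cauchy sequence $(f_i)$ in $\mathcal{C}$ such that $f_i\to f$ in $L^p(\mathbb{R})$ and, for each $n\ge1$, $f_i^{(n)}\to0$ in $L^p(\mathbb{R})$ as $i\to\infty$.
   Context: For measurable $f$ on $\mathbb{R}$, $\|f\|_p=\left(\int_{\mathbb{R}}|f(x)|^p\,dx\right)^{1/p}$, and $L^p(\mathbb{R})$ is the quasi-Banach space of (classes of) measurable $f$ with $\|f\|_p<\infty$; one has $\|f+g\|_p^p\le\|f\|_p^p+\|g\|_p^p$. For $f\in C^\infty(\mathbb{R})$ put $\|f\|_{\mathcal{M}}=\sup_{k\ge0}\frac{\|f^{(k)}\|_p}{M_k}$, and let $\mathcal{C}=\{f\in C^\infty(\mathbb{R}):\|f\|_{\mathcal{M}}<\infty\}$. $\widehat{\mathcal{C}}$ denotes the abstract completion of $\mathcal{C}$ (Cauchy sequences in $\mathcal{C}$ modulo sequences tending to $0$ in $\|\cdot\|_{\mathcal{M}}$), with the extended quasi-norm. *)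

theory Defs
  imports "HOL-Analysis.Analysis"
begin

text \<open>
  Functions take values in a scalar field \<open>'a\<close> of class \<open>real_normed_field\<close> and
  \<open>euclidean_space\<close>; the instances are \<open>real\<close> and \<open>complex\<close>, so real- and complex-valued
  functions are treated at once, and linearity below is over the scalar field \<open>'a\<close> itself.
\<close>

text \<open>The conditional is needed because \<open>enn2real \<infinity> = 0\<close>.\<close>

definition Lp_norm :: "real \<Rightarrow> (real \<Rightarrow> 'a::real_normed_vector) \<Rightarrow> ennreal" where
  "Lp_norm p f =
    (let I = (\<integral>\<^sup>+ x. ennreal (norm (f x) powr p) \<partial>lebesgue)
     in if I = \<infinity> then \<infinity> else ennreal (enn2real I powr (1 / p)))"

definition Lp_fun :: "real \<Rightarrow> (real \<Rightarrow> 'a::real_normed_vector) set" where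
  "Lp_fun p = {f. f \<in> borel_measurable lebesgue \<and> Lp_norm p f < \<infinity>}"

definition Lp_rel :: "real \<Rightarrow> ((real \<Rightarrow> 'a::real_normed_vector) \<times> (real \<Rightarrow> 'a)) set" where
  "Lp_rel p = {(f, g). f \<in> Lp_fun p \<and> g \<in> Lp_fun p \<and> (AE x in lebesgue. f x = g x)}"

definition Lp_space :: "real \<Rightarrow> (real \<Rightarrow> 'a::real_normed_vector) set set" where
  "Lp_space p = Lp_fun p // Lp_rel p"

definition nth_deriv :: "nat \<Rightarrow> (real \<Rightarrow> 'a::real_normed_vector) \<Rightarrow> real \<Rightarrow> 'a" where
  "nth_deriv k = (\<lambda>f x. vector_derivative f (at x)) ^^ k"

definition smooth :: "(real \<Rightarrow> 'a::real_normed_vector) \<Rightarrow> bool" where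
  "smooth f \<longleftrightarrow> (\<forall>k x. nth_deriv k f differentiable (at x))"

definition C_norm :: "real \<Rightarrow> (nat \<Rightarrow> real) \<Rightarrow> (real \<Rightarrow> 'a::real_normed_vector) \<Rightarrow> ennreal" where
  "C_norm p M f = (SUP k. Lp_norm p (nth_deriv k f) / ennreal (M k))"

definition C_class :: "real \<Rightarrow> (nat \<Rightarrow> real) \<Rightarrow> (real \<Rightarrow> 'a::real_normed_vector) set" where
  "C_class p M = {f. smooth f \<and> C_norm p M f < \<infinity>}"

definition C_Cauchy :: "real \<Rightarrow> (nat \<Rightarrow> real) \<Rightarrow> (nat \<Rightarrow> real \<Rightarrow> 'a::real_normed_vector) set" where
  "C_Cauchy p M = {F. (\<forall>i. F i \<in> C_class p M) \<and>
     (\<forall>\<epsilon>>0. \<exists>N. \<forall>i\<ge>N. \<forall>j\<ge>N. C_norm p M (\<lambda>x. F i x - F j x) < ennreal \<epsilon>)}"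

definition C_rel :: "real \<Rightarrow> (nat \<Rightarrow> real) \<Rightarrow>
    ((nat \<Rightarrow> real \<Rightarrow> 'a::real_normed_vector) \<times> (nat \<Rightarrow> real \<Rightarrow> 'a)) set" where
  "C_rel p M = {(F, G). F \<in> C_Cauchy p M \<and> G \<in> C_Cauchy p M \<and>
     (\<lambda>i. C_norm p M (\<lambda>x. F i x - G i x)) \<longlonglongrightarrow> 0}"

definition C_completion :: "real \<Rightarrow> (nat \<Rightarrow> real) \<Rightarrow> (nat \<Rightarrow> real \<Rightarrow> 'a::real_normed_vector) set set" where
  "C_completion p M = C_Cauchy p M // C_rel p M"

definition quot_op1 :: "('v \<times> 'v) set \<Rightarrow> ('v \<Rightarrow> 'v) \<Rightarrow> 'v set \<Rightarrow> 'v set" where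
  "quot_op1 R h X = (\<Union>u\<in>X. R `` {h u})"

definition quot_op2 :: "('v \<times> 'v) set \<Rightarrow> ('v \<Rightarrow> 'v \<Rightarrow> 'v) \<Rightarrow> 'v set \<Rightarrow> 'v set \<Rightarrow> 'v set" where
  "quot_op2 R h X Y = (\<Union>u\<in>X. \<Union>v\<in>Y. R `` {h u v})"

definition Lp_add :: "real \<Rightarrow> (real \<Rightarrow> 'a::real_normed_vector) set \<Rightarrow> (real \<Rightarrow> 'a) set \<Rightarrow> (real \<Rightarrow> 'a) set" where
  "Lp_add p = quot_op2 (Lp_rel p) (\<lambda>f g x. f x + g x)"

definition Lp_diff :: "real \<Rightarrow> (real \<Rightarrow> 'a::real_normed_vector) set \<Rightarrow> (real \<Rightarrow> 'a) set \<Rightarrow> (real \<Rightarrow> 'a) set" where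
  "Lp_diff p = quot_op2 (Lp_rel p) (\<lambda>f g x. f x - g x)"

definition Lp_scale :: "real \<Rightarrow> 'a::real_normed_field \<Rightarrow> (real \<Rightarrow> 'a) set \<Rightarrow> (real \<Rightarrow> 'a) set" where
  "Lp_scale p c = quot_op1 (Lp_rel p) (\<lambda>f x. c * f x)"

definition compl_add :: "real \<Rightarrow> (nat \<Rightarrow> real) \<Rightarrow> (nat \<Rightarrow> real \<Rightarrow> 'a::real_normed_vector) set \<Rightarrow>
    (nat \<Rightarrow> real \<Rightarrow> 'a) set \<Rightarrow> (nat \<Rightarrow> real \<Rightarrow> 'a) set" where
  "compl_add p M = quot_op2 (C_rel p M) (\<lambda>F G i x. F i x + G i x)"

definition compl_diff :: "real \<Rightarrow> (nat \<Rightarrow> real) \<Rightarrow> (nat \<Rightarrow> real \<Rightarrow> 'a::real_normed_vector) set \<Rightarrow>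
    (nat \<Rightarrow> real \<Rightarrow> 'a) set \<Rightarrow> (nat \<Rightarrow> real \<Rightarrow> 'a) set" where
  "compl_diff p M = quot_op2 (C_rel p M) (\<lambda>F G i x. F i x - G i x)"

definition compl_scale :: "real \<Rightarrow> (nat \<Rightarrow> real) \<Rightarrow> 'a::real_normed_field \<Rightarrow>
    (nat \<Rightarrow> real \<Rightarrow> 'a) set \<Rightarrow> (nat \<Rightarrow> real \<Rightarrow> 'a) set" where
  "compl_scale p M c = quot_op1 (C_rel p M) (\<lambda>F i x. c * F i x)"

text \<open>The quasi-norm of a class is the value shared by all its representatives. On the
  completion, the extended quasi-norm of the class of \<open>F\<close> is the limit of the quasi-norms
  of the \<open>F i\<close>.\<close>

definition Lp_qnorm :: "real \<Rightarrow> (real \<Rightarrow> 'a::real_normed_vector) set \<Rightarrow> ennreal" where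
  "Lp_qnorm p X = the_elem (Lp_norm p ` X)"

definition compl_qnorm :: "real \<Rightarrow> (nat \<Rightarrow> real) \<Rightarrow> (nat \<Rightarrow> real \<Rightarrow> 'a::real_normed_vector) set \<Rightarrow> ennreal" where
  "compl_qnorm p M X = the_elem ((\<lambda>F. lim (\<lambda>i. C_norm p M (F i))) ` X)"

definition linear_Lp_compl ::
  "real \<Rightarrow> (nat \<Rightarrow> real) \<Rightarrow> ((real \<Rightarrow> 'a::real_normed_field) set \<Rightarrow> (nat \<Rightarrow> real \<Rightarrow> 'a) set) \<Rightarrow> bool" where
  "linear_Lp_compl p M T \<longleftrightarrow>
     (\<forall>X\<in>Lp_space p. \<forall>Y\<in>Lp_space p. T (Lp_add p X Y) = compl_add p M (T X) (T Y)) \<and>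
     (\<forall>c. \<forall>X\<in>Lp_space p. T (Lp_scale p c X) = compl_scale p M c (T X))"

definition continuous_Lp_compl ::
  "real \<Rightarrow> (nat \<Rightarrow> real) \<Rightarrow> ((real \<Rightarrow> 'a::real_normed_vector) set \<Rightarrow> (nat \<Rightarrow> real \<Rightarrow> 'a) set) \<Rightarrow> bool" where
  "continuous_Lp_compl p M T \<longleftrightarrow>
     (\<forall>X\<in>Lp_space p. \<forall>\<epsilon>>0. \<exists>\<delta>>0. \<forall>Y\<in>Lp_space p.
        Lp_qnorm p (Lp_diff p Y X) < ennreal \<delta> \<longrightarrow>
        compl_qnorm p M (compl_diff p M (T Y) (T X)) < ennreal \<epsilon>)"

definition flat_approx ::
  "real \<Rightarrow> (nat \<Rightarrow> real) \<Rightarrow> (real \<Rightarrow> 'a::real_normed_vector) \<Rightarrow> (nat \<Rightarrow> real \<Rightarrow> 'a) set" where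
  "flat_approx p M f = {F \<in> C_Cauchy p M.
     (\<lambda>i. Lp_norm p (\<lambda>x. F i x - f x)) \<longlonglongrightarrow> 0 \<and>
     (\<forall>n\<ge>1. (\<lambda>i. Lp_norm p (nth_deriv n (F i))) \<longlonglongrightarrow> 0)}"

end

theory Submission
  imports Defs
begin

text \<open>
  The class of \<open>f\<close> is sent to the set of all flat approximations of \<open>f\<close>, which is a full class
  of the completion: if \<open>F\<close> is flat over \<open>f\<close>, then \<open>C_norm p M (F i)\<close> tends to
  \<open>Lp_norm p f / M 0\<close>, so two flat approximations of \<open>f\<close> differ by a null sequence. This also
  makes the map isometric up to the factor \<open>M 0\<close>, which gives continuity.

  Existence of flat approximations reduces by density to one smooth step whose derivatives of all
  orders \<open>k \<ge> 1\<close> are uniformly small in \<open>L^p\<close>. Convolve the Heaviside function with normalised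
  boxes of rapidly decreasing widths \<open>w 0, w 1, \<dots>\<close>. The derivative of order \<open>n + 1\<close> is
  bounded by \<open>1 / (w 0 * \<dots> * w n)\<close> and lives on \<open>2 ^ n\<close> intervals of length at most \<open>2 * w n\<close>,
  so the integral of its \<open>p\<close>-th power is at most
  \<open>2 ^ (n + 1) * (w 0 * \<dots> * w (n - 1)) powr - p * w n powr (1 - p)\<close>; since \<open>p < 1\<close>, this is
  small once \<open>w n\<close> is small enough in terms of the previous widths.
\<close>

section \<open>Integrals of p-th powers\<close>

text \<open>For \<open>p \<le> 1\<close> the integral \<open>Lp_int\<close> is subadditive with
  constant 1, whereas the quasi-norm picks up a factor at every sum; estimates are therefore made on
  \<open>Lp_int\<close> and translated to quasi-norms afterwards. A jump is cheap when
  \<open>p < 1\<close>: a slope of height \<open>1 / w\<close> on length \<open>w\<close> has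
  p-integral \<open>w powr (1 - p)\<close>. The obstacle is to treat all orders at once. The weights
  may all be 1, so the bound on the derivatives must be uniform in the order, and rescaling one
  fixed mollifier fails: it multiplies the p-integral of the derivative of order \<open>k\<close> by
  \<open>w powr (1 - k * p)\<close>, which blows up as soon as \<open>k * p > 1\<close>. Hence every
  order gets a width of its own, chosen after all earlier ones so that its gain outweighs their
  accumulated cost. Finitely many boxes give only finite regularity, which is why a limit of
  iterated averages is needed.\<close>

definition Lp_int :: "real \<Rightarrow> (real \<Rightarrow> 'a::real_normed_vector) \<Rightarrow> ennreal" where
  "Lp_int p f = (\<integral>\<^sup>+ x. ennreal (norm (f x) powr p) \<partial>lebesgue)"

text \<open>After division by \<open>a + b\<close> both terms lie between 0 and 1, where
  \<open>t \<le> t powr p\<close>.\<close>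

lemma powr_add_le:
  fixes a b p :: real
  assumes "0 \<le> a" "0 \<le> b" "0 < p" "p \<le> 1"
  shows "(a + b) powr p \<le> a powr p + b powr p"
proof (cases "a + b = 0")
  case True
  then show ?thesis using assms by simp
next
  case False
  define s where "s = a + b"
  have s: "s > 0" using assms False s_def by linarith
  have *: "t \<le> t powr p" if "0 \<le> t" "t \<le> 1" for t :: real
    using powr_mono'[of p 1 t] that assms by simp
  have "1 = a / s + b / s" using s by (simp add: s_def flip: add_divide_distrib)
  also have "\<dots> \<le> (a / s) powr p + (b / s) powr p"
    using s assms by (intro add_mono *) (auto simp: s_def field_simps)
  also have "\<dots> = (a powr p + b powr p) / s powr p"
    using s assms by (simp add: powr_divide add_divide_distrib)
  finally show ?thesis using s by (simp add: s_def field_simps)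
qed

lemma Lp_int_add_le:
  fixes f g :: "real \<Rightarrow> 'a::euclidean_space"
  assumes [measurable]: "f \<in> borel_measurable lebesgue" "g \<in> borel_measurable lebesgue"
    and p: "0 < p" "p \<le> 1"
  shows "Lp_int p (\<lambda>x. f x + g x) \<le> Lp_int p f + Lp_int p g"
proof -
  have "Lp_int p (\<lambda>x. f x + g x)
      \<le> (\<integral>\<^sup>+ x. ennreal (norm (f x) powr p) + ennreal (norm (g x) powr p) \<partial>lebesgue)"
    unfolding Lp_int_def
  proof (intro nn_integral_mono)
    fix x
    have "norm (f x + g x) powr p \<le> (norm (f x) + norm (g x)) powr p"
      using p by (intro powr_mono2 norm_triangle_ineq) auto
    also have "\<dots> \<le> norm (f x) powr p + norm (g x) powr p"
      using p by (intro powr_add_le) auto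
    finally show "ennreal (norm (f x + g x) powr p)
        \<le> ennreal (norm (f x) powr p) + ennreal (norm (g x) powr p)"
      by (simp flip: ennreal_plus add: ennreal_leI)
  qed
  also have "\<dots> = Lp_int p f + Lp_int p g"
    unfolding Lp_int_def by (intro nn_integral_add) measurable
  finally show ?thesis .
qed

text \<open>The hypothesis on norms lets one statement serve multiplication in the field, real
  scaling and division of real functions.\<close>

lemma Lp_int_cmult:
  fixes f :: "real \<Rightarrow> 'a::euclidean_space" and g :: "real \<Rightarrow> 'b::euclidean_space"
  assumes [measurable]: "f \<in> borel_measurable lebesgue" and c: "c \<ge> 0"
    and eq: "\<And>x. norm (g x) = c * norm (f x)"
  shows "Lp_int p g = ennreal (c powr p) * Lp_int p f"
  unfolding Lp_int_def eq
  using c by (subst nn_integral_cmult[symmetric]) (auto simp: powr_mult ennreal_mult)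

lemma Lp_int_minus [simp]: "Lp_int p (\<lambda>x. - f x) = Lp_int p f"
  by (simp add: Lp_int_def)

lemma Lp_int_zero [simp]: "Lp_int p (\<lambda>x. 0) = 0"
  by (simp add: Lp_int_def)

lemma Lp_int_diff_commute: "Lp_int p (\<lambda>x. f x - g x) = Lp_int p (\<lambda>x. g x - f x)"
  by (simp add: Lp_int_def norm_minus_commute)

lemma Lp_int_diff_le:
  fixes f g :: "real \<Rightarrow> 'a::euclidean_space"
  assumes "f \<in> borel_measurable lebesgue" "g \<in> borel_measurable lebesgue" "0 < p" "p \<le> 1"
  shows "Lp_int p (\<lambda>x. f x - g x) \<le> Lp_int p f + Lp_int p g"
  using Lp_int_add_le[of f "\<lambda>x. - g x" p] assms by simp

lemma Lp_int_triangle: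
  fixes f g h :: "real \<Rightarrow> 'a::euclidean_space"
  assumes [measurable]: "f \<in> borel_measurable lebesgue" "g \<in> borel_measurable lebesgue"
    "h \<in> borel_measurable lebesgue" and p: "0 < p" "p \<le> 1"
  shows "Lp_int p (\<lambda>x. f x - h x) \<le> Lp_int p (\<lambda>x. f x - g x) + Lp_int p (\<lambda>x. g x - h x)"
  using Lp_int_add_le[of "\<lambda>x. f x - g x" "\<lambda>x. g x - h x" p] p by simp

lemma Lp_int_shift:
  fixes f :: "real \<Rightarrow> 'a::euclidean_space"
  assumes [measurable]: "f \<in> borel_measurable lebesgue"
  shows "Lp_int p (\<lambda>x. f (x - w)) = Lp_int p f"
  using nn_integral_real_affine_lebesgue[of "\<lambda>x. ennreal (norm (f x) powr p)" 1 "-w"]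
  by (simp add: Lp_int_def)

lemma Lp_int_mono:
  assumes "\<And>x. norm (f x) \<le> norm (g x)" "0 < p"
  shows "Lp_int p f \<le> Lp_int p g"
  unfolding Lp_int_def using assms by (intro nn_integral_mono ennreal_leI powr_mono2) auto

lemma Lp_int_bounded_support:
  assumes "\<And>x. x \<notin> {a..b} \<Longrightarrow> f x = 0" "\<And>x. norm (f x) \<le> C" "a \<le> b" "0 < p"
  shows "Lp_int p f \<le> ennreal (C powr p * (b - a))"
proof -
  have "0 \<le> C" using assms(2)[of 0] norm_ge_zero order_trans by blast
  have "Lp_int p f \<le> (\<integral>\<^sup>+ x. ennreal (C powr p) * indicator {a..b} x \<partial>lebesgue)"
    unfolding Lp_int_def
  proof (intro nn_integral_mono)
    fix x
    show "ennreal (norm (f x) powr p) \<le> ennreal (C powr p) * indicator {a..b} x"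
      using assms(1)[of x] powr_mono2[OF _ _ assms(2)[of x], of p] \<open>0 < p\<close>
      by (cases "x \<in> {a..b}") (auto intro: ennreal_leI)
  qed
  also have "\<dots> = ennreal (C powr p * (b - a))"
    using \<open>a \<le> b\<close> by (subst nn_integral_cmult_indicator) (auto simp: ennreal_mult')
  finally show ?thesis .
qed

section \<open>Smooth steps with small derivatives\<close>

text \<open>Convolution with the density \<open>1 / w\<close> on \<open>[0, w]\<close>. The box
  looks only to the left, so a function that vanishes for \<open>x \<le> 0\<close> still does so
  after averaging.\<close>

definition box_avg :: "real \<Rightarrow> (real \<Rightarrow> real) \<Rightarrow> real \<Rightarrow> real" where
  "box_avg w g x = integral {x - w..x} g / w"

definition diff_quot :: "real \<Rightarrow> (real \<Rightarrow> real) \<Rightarrow> real \<Rightarrow> real" where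
  "diff_quot w g x = (g x - g (x - w)) / w"

text \<open>Monotonicity provides integrability on intervals for the Heaviside function and for the
  limit steps, before any continuity is known.\<close>

definition step_fun :: "real \<Rightarrow> (real \<Rightarrow> real) \<Rightarrow> bool" where
  "step_fun r g \<longleftrightarrow> mono g \<and> (\<forall>x. 0 \<le> g x \<and> g x \<le> 1) \<and> (\<forall>x\<le>0. g x = 0) \<and> (\<forall>x>r. g x = 1)"

lemma step_fun_integrable: "step_fun r g \<Longrightarrow> g integrable_on {a..b}"
  unfolding step_fun_def by (intro integrable_on_mono_on) (auto simp: mono_on_def mono_def)

lemma box_avg_le:
  assumes "step_fun r g" "w > 0" "\<And>y. x - w \<le> y \<Longrightarrow> y \<le> x \<Longrightarrow> g y \<le> c"
  shows "box_avg w g x \<le> c"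
proof -
  have "integral {x - w..x} g \<le> integral {x - w..x} (\<lambda>_. c)"
    using assms by (intro integral_le step_fun_integrable[OF assms(1)]) auto
  then show ?thesis using assms(2) by (simp add: box_avg_def field_simps)
qed

lemma box_avg_ge:
  assumes "step_fun r g" "w > 0" "\<And>y. x - w \<le> y \<Longrightarrow> y \<le> x \<Longrightarrow> c \<le> g y"
  shows "c \<le> box_avg w g x"
proof -
  have "integral {x - w..x} (\<lambda>_. c) \<le> integral {x - w..x} g"
    using assms by (intro integral_le step_fun_integrable[OF assms(1)]) auto
  then show ?thesis using assms(2) by (simp add: box_avg_def field_simps)
qed

lemma box_avg_mono:
  assumes "step_fun r g" "step_fun s h" "w > 0" "\<And>y. g y \<le> h y"
  shows "box_avg w g x \<le> box_avg w h x"
  unfolding box_avg_def using assms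
  by (intro divide_right_mono integral_le step_fun_integrable) auto

text \<open>The interval \<open>{x - w..y}\<close> is split once at \<open>x\<close> and once at
  \<open>y - w\<close>; comparing the two splittings gives the identity.\<close>

lemma integral_split_diff:
  fixes g :: "real \<Rightarrow> real"
  assumes "step_fun r g" "x \<le> y" "0 < w"
  shows "integral {y - w..y} g - integral {x - w..x} g = integral {x..y} g - integral {x - w..y - w} g"
proof -
  have i: "g integrable_on {x - w..y}" using assms(1) step_fun_integrable by blast
  have "integral {x - w..x} g + integral {x..y} g = integral {x - w..y} g"
    using assms by (intro Henstock_Kurzweil_Integration.integral_combine i) auto
  moreover have "integral {x - w..y - w} g + integral {y - w..y} g = integral {x - w..y} g"
    using assms by (intro Henstock_Kurzweil_Integration.integral_combine i) auto
  ultimately show ?thesis by simp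
qed

lemma step_fun_box_avg:
  assumes g: "step_fun r g" and w: "0 < w" "r + w \<le> s"
  shows "step_fun s (box_avg w g)"
proof -
  have b: "0 \<le> g x" "g x \<le> 1" for x using g by (auto simp: step_fun_def)
  have z: "g x = 0" if "x \<le> 0" for x using g that by (auto simp: step_fun_def)
  have o: "g x = 1" if "r < x" for x using g that by (auto simp: step_fun_def)
  have m: "g x \<le> g y" if "x \<le> y" for x y using g that by (auto simp: step_fun_def mono_def)
  \<comment> \<open>For overlapping windows the common part cancels: the piece gained has values at
    least \<open>g x\<close>, the piece lost has values at most \<open>g x\<close>. For disjoint
    windows \<open>g x\<close> separates the two averages.\<close>
  have mono: "box_avg w g x \<le> box_avg w g y" if "x \<le> y" for x y
  proof (cases "y - w \<le> x")
    case True
    have "integral {x - w..y - w} g \<le> integral {x - w..y - w} (\<lambda>_. g x)"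
      using True by (intro integral_le step_fun_integrable[OF g] m) auto
    also have "\<dots> = integral {x..y} (\<lambda>_. g x)" using that by simp
    also have "\<dots> \<le> integral {x..y} g"
      by (intro integral_le step_fun_integrable[OF g] m) auto
    finally show ?thesis
      using integral_split_diff[OF g that w(1)] w by (simp add: box_avg_def divide_right_mono)
  next
    case False
    have "box_avg w g x \<le> g x"
      using m by (intro box_avg_le[OF g]) (auto simp: w)
    also have "\<dots> \<le> box_avg w g y"
      using m False by (intro box_avg_ge[OF g]) (auto simp: w)
    finally show ?thesis .
  qed
  have "0 \<le> box_avg w g x" "box_avg w g x \<le> 1" for x
    by (auto intro!: box_avg_le[OF g] box_avg_ge[OF g] b simp: w)
  moreover have "box_avg w g x \<le> 0" if "x \<le> 0" for x
    using that by (intro box_avg_le[OF g]) (auto simp: z w)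
  moreover have "1 \<le> box_avg w g x" if "s < x" for x
    using that w by (intro box_avg_ge[OF g]) (auto simp: o)
  ultimately show ?thesis
    unfolding step_fun_def using mono by (auto simp: mono_def intro: antisym)
qed

text \<open>By \<open>integral_split_diff\<close> the change of the window integral is a difference
  of two numbers in \<open>[0, y - x]\<close>, so the average is Lipschitz with constant
  \<open>1 / w\<close>, even if \<open>g\<close> jumps.\<close>

lemma continuous_box_avg:
  assumes g: "step_fun r g" and w: "0 < w"
  shows "continuous_on UNIV (box_avg w g)"
proof -
  have b: "0 \<le> g x" "g x \<le> 1" for x using g by (auto simp: step_fun_def)
  have i: "0 \<le> integral {x..y} g" "integral {x..y} g \<le> y - x" if "x \<le> y" for x y
  proof -
    show "0 \<le> integral {x..y} g"
      by (intro Henstock_Kurzweil_Integration.integral_nonneg step_fun_integrable[OF g] b)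
    have "integral {x..y} g \<le> integral {x..y} (\<lambda>_. 1)"
      by (intro integral_le step_fun_integrable[OF g] b) auto
    then show "integral {x..y} g \<le> y - x" using that by simp
  qed
  have le: "\<bar>box_avg w g y - box_avg w g x\<bar> \<le> 1 / w * \<bar>y - x\<bar>" if "x \<le> y" for x y
  proof -
    have "box_avg w g y - box_avg w g x = (integral {x..y} g - integral {x - w..y - w} g) / w"
      unfolding integral_split_diff[OF g that w, symmetric] by (simp add: box_avg_def diff_divide_distrib)
    moreover have "\<bar>integral {x..y} g - integral {x - w..y - w} g\<bar> \<le> y - x"
      using i[OF that] i[of "x - w" "y - w"] that by linarith
    ultimately show ?thesis using that w by (simp add: abs_divide divide_right_mono)
  qed
  have "(1 / w)-lipschitz_on UNIV (box_avg w g)"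
  proof (rule lipschitz_onI)
    fix x y
    show "dist (box_avg w g x) (box_avg w g y) \<le> 1 / w * dist x y"
      using le[of x y] le[of y x] by (cases "x \<le> y") (auto simp: dist_real_def abs_minus_commute)
  qed (use w in simp)
  then show ?thesis by (rule lipschitz_on_continuous_on)
qed

lemma DERIV_box_avg:
  assumes g: "continuous_on UNIV g" and w: "0 < w"
  shows "(box_avg w g has_real_derivative diff_quot w g x) (at x)"
proof -
  \<comment> \<open>The margin 1 keeps the window of every \<open>y\<close> within distance 1 of
    \<open>x\<close> inside the interval, and makes \<open>x\<close> and \<open>x - w\<close>
    interior points.\<close>
  have "continuous_on {x - w - 1..x + 1} g" using g continuous_on_subset by blast
  then obtain F where F: "\<And>y. y \<in> {x - w - 1..x + 1} \<Longrightarrow>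
      (F has_vector_derivative g y) (at y within {x - w - 1..x + 1})"
    by (rule antiderivative_continuous) blast
  have eq: "box_avg w g y = (F y - F (y - w)) / w" if "y \<in> {x - 1<..<x + 1}" for y
  proof -
    have "(g has_integral (F y - F (y - w))) {y - w..y}"
    proof (rule fundamental_theorem_of_calculus)
      fix u assume "u \<in> {y - w..y}"
      then show "(F has_vector_derivative g u) (at u within {y - w..y})"
        using that w by (intro has_vector_derivative_within_subset[OF F]) auto
    qed (use w in auto)
    then show ?thesis by (simp add: box_avg_def integral_unique)
  qed
  have D: "(F has_real_derivative g y) (at y)" if "y = x \<or> y = x - w" for y
  proof -
    have "y \<in> interior {x - w - 1..x + 1}" using that w by auto
    then have "at y within {x - w - 1..x + 1} = at y" by (rule at_within_interior)
    then show ?thesis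
      using F[of y] that w by (auto simp: has_real_derivative_iff_has_vector_derivative)
  qed
  have "((\<lambda>y. F (y - w)) has_real_derivative g (x - w)) (at x)"
    using D[of "x - w"] DERIV_shift[of F "g (x - w)" x "- w"] by simp
  then have "((\<lambda>y. (F y - F (y - w)) / w) has_real_derivative diff_quot w g x) (at x)"
    unfolding diff_quot_def using D[of x] by (auto intro!: DERIV_cdivide DERIV_diff)
  then show ?thesis
    by (rule has_field_derivative_transform_within_open[of _ _ _ "{x - 1<..<x + 1}"]) (auto simp: eq)
qed

lemma nth_deriv_Suc: "nth_deriv (Suc k) f = (\<lambda>x. vector_derivative (nth_deriv k f) (at x))"
  by (simp add: nth_deriv_def)

lemma nth_deriv_0 [simp]: "nth_deriv 0 f = f"
  by (simp add: nth_deriv_def)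

text \<open>Smoothness is always shown by exhibiting the whole chain of derivatives; the same chain
  then identifies \<open>nth_deriv\<close>.\<close>

lemma smoothI_derivs:
  assumes "\<And>k x. (D k has_vector_derivative D (Suc k) x) (at x)"
  shows "smooth (D 0)" "nth_deriv k (D 0) = D k"
proof -
  have eq: "nth_deriv k (D 0) = D k" for k
    by (induction k) (auto simp: nth_deriv_Suc vector_derivative_at[OF assms])
  then show "nth_deriv k (D 0) = D k" .
  show "smooth (D 0)"
    unfolding smooth_def eq using assms differentiableI_vector by blast
qed

text \<open>The Heaviside function averaged \<open>n\<close> times, with widths
  \<open>w k, ..., w (k + n - 1)\<close>. The widest box \<open>w k\<close> is outermost, so that
  the limit over \<open>n\<close> keeps it as its outermost operation.\<close>

fun step_approx :: "(nat \<Rightarrow> real) \<Rightarrow> nat \<Rightarrow> nat \<Rightarrow> real \<Rightarrow> real" where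
  "step_approx w 0 k = (\<lambda>x. if x > 0 then 1 else 0)"
| "step_approx w (Suc n) k = box_avg (w k) (step_approx w n (Suc k))"

definition step_lim :: "(nat \<Rightarrow> real) \<Rightarrow> nat \<Rightarrow> real \<Rightarrow> real" where
  "step_lim w k x = lim (\<lambda>n. step_approx w n k x)"

text \<open>The derivative of order \<open>n\<close> of \<open>step_lim w k\<close>: each
  differentiation turns one more box, from the outside inwards, into a difference quotient, and
  \<open>step_lim w (k + n)\<close> remains inside.\<close>

fun step_deriv :: "(nat \<Rightarrow> real) \<Rightarrow> nat \<Rightarrow> nat \<Rightarrow> real \<Rightarrow> real" where
  "step_deriv w 0 k = step_lim w k"
| "step_deriv w (Suc n) k = diff_quot (w k) (step_deriv w n (Suc k))"

text \<open>Halving bounds every sum \<open>w k + w (k + 1) + ...\<close> by \<open>2 * w k\<close>,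
  so all approximations starting at \<open>k\<close> climb from 0 to 1 inside
  \<open>{0..2 * w k}\<close>, however many boxes are used.\<close>

locale step_widths =
  fixes w :: "nat \<Rightarrow> real"
  assumes pos: "\<And>k. 0 < w k" and half: "\<And>k. 2 * w (Suc k) \<le> w k"
begin

lemma step_approx: "step_fun (2 * w k) (step_approx w n k)"
proof (induction n arbitrary: k)
  case 0
  show ?case using pos[of k] by (auto simp: step_fun_def mono_def)
next
  case (Suc n)
  show ?case using step_fun_box_avg[OF Suc[of "Suc k"] pos[of k], of "2 * w k"] half[of k] by simp
qed

text \<open>A further box is inserted innermost, next to the Heaviside function. A left-sided
  average of an increasing function lies below it, and the outer averages preserve the
  order.\<close>

lemma step_approx_decr: "step_approx w (Suc n) k x \<le> step_approx w n k x"
proof (induction n arbitrary: k x)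
  case 0
  have g: "step_fun (2 * w (Suc k)) (step_approx w 0 (Suc k))" by (rule step_approx)
  show ?case
    using g pos[of k] by (auto intro!: box_avg_le[OF g[simplified]])
next
  case (Suc n)
  have "box_avg (w k) (step_approx w (Suc n) (Suc k)) x \<le> box_avg (w k) (step_approx w n (Suc k)) x"
    by (rule box_avg_mono[OF step_approx step_approx pos Suc])
  then show ?case by simp
qed

lemma step_lim: "(\<lambda>n. step_approx w n k x) \<longlonglongrightarrow> step_lim w k x"
proof -
  have "decseq (\<lambda>n. step_approx w n k x)"
    using step_approx_decr by (rule decseq_SucI)
  moreover have "0 \<le> step_approx w n k x" for n
    using step_approx[of k n] by (auto simp: step_fun_def)
  ultimately obtain L where "(\<lambda>n. step_approx w n k x) \<longlonglongrightarrow> L"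
    by (metis decseq_convergent)
  then show ?thesis unfolding step_lim_def by (metis limI)
qed

lemma step_fun_step_lim: "step_fun (2 * w k) (step_lim w k)"
  unfolding step_fun_def
proof (intro conjI allI impI monoI)
  have a: "step_fun (2 * w k) (step_approx w n k)" for n by (rule step_approx)
  show "step_lim w k x \<le> step_lim w k y" if "x \<le> y" for x y
    using a that by (intro LIMSEQ_le[OF step_lim step_lim]) (auto simp: step_fun_def mono_def)
  show "0 \<le> step_lim w k x" for x
    using a by (intro LIMSEQ_le_const[OF step_lim]) (auto simp: step_fun_def)
  show "step_lim w k x \<le> 1" for x
    using a by (intro LIMSEQ_le_const2[OF step_lim]) (auto simp: step_fun_def)
  show "step_lim w k x = 0" if "x \<le> 0" for x
    using LIMSEQ_unique[OF step_lim, of k x 0] a that by (simp add: step_fun_def)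
  show "step_lim w k x = 1" if "x > 2 * w k" for x
    using LIMSEQ_unique[OF step_lim, of k x 1] a that by (simp add: step_fun_def)
qed

text \<open>Dominated convergence with bound 1 on a fixed window. All regularity of the limit steps
  comes from this equation, which shows each of them as an average of the next one.\<close>

lemma step_lim_eq: "step_lim w k = box_avg (w k) (step_lim w (Suc k))"
proof
  fix x
  have "(\<lambda>n. integral {x - w k..x} (step_approx w n (Suc k))) \<longlonglongrightarrow> integral {x - w k..x} (step_lim w (Suc k))"
  proof (rule dominated_convergence(2))
    show "step_approx w n (Suc k) integrable_on {x - w k..x}" for n
      using step_approx by (rule step_fun_integrable)
    show "norm (step_approx w n (Suc k) y) \<le> 1" for n y
      using step_approx[of "Suc k" n] by (auto simp: step_fun_def)
  qed (auto intro: step_lim)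
  then have "(\<lambda>n. step_approx w (Suc n) k x) \<longlonglongrightarrow> box_avg (w k) (step_lim w (Suc k)) x"
    unfolding step_approx.simps box_avg_def using pos[of k] by (intro tendsto_divide) auto
  moreover have "(\<lambda>n. step_approx w (Suc n) k x) \<longlonglongrightarrow> step_lim w k x"
    using step_lim by (rule LIMSEQ_Suc)
  ultimately show "step_lim w k x = box_avg (w k) (step_lim w (Suc k)) x"
    using LIMSEQ_unique by blast
qed

lemma continuous_step_lim: "continuous_on UNIV (step_lim w k)"
  by (subst step_lim_eq) (rule continuous_box_avg[OF step_fun_step_lim pos])

text \<open>Differentiation commutes with the outer difference quotient, so the induction lowers
  \<open>n\<close> while raising \<open>k\<close>. In the base case the average in
  \<open>step_lim_eq\<close> is differentiated.\<close>

lemma DERIV_step_deriv: "(step_deriv w n k has_real_derivative step_deriv w (Suc n) k x) (at x)"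
proof (induction n arbitrary: k x)
  case 0
  show ?case
    using DERIV_box_avg[OF continuous_step_lim[of "Suc k"] pos[of k], of x] by (simp flip: step_lim_eq)
next
  case (Suc n)
  let ?g = "step_deriv w n (Suc k)"
  have "((\<lambda>y. ?g (y - w k)) has_real_derivative step_deriv w (Suc n) (Suc k) (x - w k)) (at x)"
    using Suc[of "Suc k" "x - w k"] DERIV_shift[of ?g "step_deriv w (Suc n) (Suc k) (x - w k)" x "- w k"]
    by (simp del: step_deriv.simps)
  then have "((\<lambda>y. (?g y - ?g (y - w k)) / w k) has_real_derivative
      diff_quot (w k) (step_deriv w (Suc n) (Suc k)) x) (at x)"
    unfolding diff_quot_def[of _ "step_deriv w (Suc n) (Suc k)"]
    using Suc[of "Suc k" x] by (intro DERIV_cdivide DERIV_diff)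
  then show ?case
    unfolding step_deriv.simps(2)[of _ "Suc n"] unfolding step_deriv.simps(2)[of _ n k] diff_quot_def[of _ ?g, abs_def] .
qed

lemma step_deriv_measurable [measurable]: "step_deriv w n k \<in> borel_measurable lebesgue"
proof -
  have "continuous_on UNIV (step_deriv w n k)"
    using DERIV_isCont[OF DERIV_step_deriv] by (auto simp: continuous_on_eq_continuous_at)
  then show ?thesis
    by (intro measurable_completion) (simp add: borel_measurable_continuous_onI)
qed

text \<open>The inner step is complete after \<open>2 * w (Suc k) \<le> w k\<close>, so its
  difference quotient lives on \<open>{0..2 * w k}\<close> and has height at most
  \<open>1 / w k\<close>. Length times the p-th power of the height gives the exponent
  \<open>1 - p\<close>.\<close>

lemma Lp_int_step_deriv_1:
  assumes "0 < p"
  shows "Lp_int p (step_deriv w (Suc 0) k) \<le> ennreal (2 * w k powr (1 - p))"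
proof -
  have s: "step_fun (2 * w (Suc k)) (step_lim w (Suc k))" by (rule step_fun_step_lim)
  have "Lp_int p (step_deriv w (Suc 0) k) \<le> ennreal ((1 / w k) powr p * (2 * w k - 0))"
  proof (rule Lp_int_bounded_support)
    show "step_deriv w (Suc 0) k x = 0" if "x \<notin> {0..2 * w k}" for x
      using that s half[of k] pos[of k] by (auto simp: diff_quot_def step_fun_def not_le)
    have b: "0 \<le> step_lim w (Suc k) x" "step_lim w (Suc k) x \<le> 1" for x
      using s by (auto simp: step_fun_def)
    show "norm (step_deriv w (Suc 0) k x) \<le> 1 / w k" for x
      using b[of x] b[of "x - w k"] pos[of k]
      by (auto simp: diff_quot_def abs_divide divide_right_mono intro!: divide_right_mono)
  qed (use pos[of k] assms in auto)
  also have "(1 / w k) powr p * (2 * w k - 0) = 2 * w k powr (1 - p)"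
    using pos[of k] by (simp add: powr_divide powr_diff)
  finally show ?thesis .
qed

text \<open>Subadditivity and translation invariance, applied to a function and its translate, give
  the factor 2; this replaces a count of the intervals of the support.\<close>

lemma Lp_int_step_deriv_Suc:
  assumes "0 < p" "p \<le> 1"
  shows "Lp_int p (step_deriv w (Suc n) k) \<le> ennreal (2 / w k powr p) * Lp_int p (step_deriv w n (Suc k))"
proof -
  let ?g = "step_deriv w n (Suc k)"
  have g: "?g \<in> borel_measurable lebesgue" by (rule step_deriv_measurable)
  then have sh: "(\<lambda>x. ?g (x - w k)) \<in> borel_measurable lebesgue"
    using lebesgue_affine_measurable[where c= "\<lambda>x::real. 1" and t="- w k"] by (simp add: measurable_compose)
  have "Lp_int p (step_deriv w (Suc n) k) = ennreal ((1 / w k) powr p) * Lp_int p (\<lambda>x. ?g x - ?g (x - w k))"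
    using g sh pos[of k] by (intro Lp_int_cmult) (auto simp: diff_quot_def abs_divide)
  also have "\<dots> \<le> ennreal ((1 / w k) powr p) * (Lp_int p ?g + Lp_int p (\<lambda>x. ?g (x - w k)))"
    using g sh assms by (intro mult_left_mono Lp_int_diff_le) auto
  also have "\<dots> = ennreal ((1 / w k) powr p) * (2 * Lp_int p ?g)"
    by (simp add: Lp_int_shift[OF g] mult_2)
  also have "\<dots> = ennreal (2 / w k powr p) * Lp_int p ?g"
  proof -
    have "ennreal (2 / w k powr p) = ennreal ((1 / w k) powr p) * 2"
      using pos[of k] by (simp add: powr_divide flip: ennreal_numeral ennreal_mult)
    then show ?thesis by (simp add: mult.assoc)
  qed
  finally show ?thesis .
qed

end

text \<open>\<open>P k\<close> is the factor that \<open>k\<close> difference quotients of widths \<open>w 0, \<dots>, w (k - 1)\<close> can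
  contribute to the integral of the \<open>p\<close>-th power.\<close>

lemma exists_step_widths:
  fixes p e :: real
  assumes "p < 1" "0 < e"
  obtains w P where "step_widths w" "2 * w 0 \<le> e" "P 0 = 1"
    "\<And>k. P (Suc k) = P k * (2 / w k powr p)" "\<And>k. P k * (2 * w k powr (1 - p)) \<le> e"
    "\<And>k. 0 \<le> P k"
proof -
  define ok where "ok = (\<lambda>(v, Q). 0 < v \<and> 0 < Q \<and> Q * (2 * v powr (1 - p)) \<le> e)"
  have ex: "\<exists>v. ok (v, Q) \<and> v \<le> b" if "0 < Q" "0 < b" for Q b
  proof -
    \<comment> \<open>The second entry solves \<open>Q * (2 * v powr (1 - p)) = e\<close> for
      \<open>v\<close>, which works because the exponent \<open>1 - p\<close> is positive.\<close>
    define v where "v = min b ((e / (2 * Q)) powr (1 / (1 - p)))"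
    have "v powr (1 - p) \<le> ((e / (2 * Q)) powr (1 / (1 - p))) powr (1 - p)"
      using assms that by (intro powr_mono2) (auto simp: v_def)
    also have "\<dots> = e / (2 * Q)" using assms that by (simp add: powr_powr)
    finally have "Q * (2 * v powr (1 - p)) \<le> e" using that by (simp add: field_simps)
    moreover have "0 < v" "v \<le> b" using assms that by (auto simp: v_def)
    ultimately show ?thesis using that by (auto simp: ok_def)
  qed
  obtain f where f0: "ok (f 0) \<and> (\<exists>v. f 0 = (v, 1) \<and> v \<le> e / 2)" and
    f: "\<And>n. ok (f (Suc n)) \<and> snd (f (Suc n)) = snd (f n) * (2 / fst (f n) powr p) \<and>
        fst (f (Suc n)) \<le> fst (f n) / 2"
  proof -
    \<comment> \<open>The bound \<open>e / 2\<close> on the first width places the whole transition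
      of the final step inside \<open>{0..e}\<close>.\<close>
    obtain v where v: "ok (v, 1)" "v \<le> e / 2" using ex[of 1 "e / 2"] assms by auto
    have "\<exists>f. f 0 = (v, 1) \<and> (\<forall>n. ok (f n) \<and> ok (f (Suc n)) \<and>
        snd (f (Suc n)) = snd (f n) * (2 / fst (f n) powr p) \<and> fst (f (Suc n)) \<le> fst (f n) / 2)"
    proof -
      \<comment> \<open>A state pairs the current width with the factor accumulated before it. The
        new factor is fixed by the old state, and only then is the new width chosen small enough for
        it.\<close>
      define nxt where "nxt = (\<lambda>(u, Q). (SOME v. ok (v, Q * (2 / u powr p)) \<and> v \<le> u / 2, Q * (2 / u powr p)))"
      have nxt: "ok (nxt z) \<and> snd (nxt z) = snd z * (2 / fst z powr p) \<and> fst (nxt z) \<le> fst z / 2" if "ok z" for z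
      proof -
        obtain u Q where z: "z = (u, Q)" by (cases z)
        have "\<exists>v. ok (v, Q * (2 / u powr p)) \<and> v \<le> u / 2"
          using that z by (intro ex) (auto simp: ok_def)
        from someI_ex[OF this] show ?thesis by (simp add: z nxt_def)
      qed
      define f where "f n = (nxt ^^ n) (v, 1)" for n
      have "ok (f n)" for n by (induction n) (auto simp: f_def v nxt)
      then show ?thesis using nxt by (intro exI[of _ f]) (auto simp: f_def)
    qed
    then show ?thesis using that v by metis
  qed
  have okf: "ok (f n)" for n using f0 f by (cases n) auto
  show ?thesis
  proof (rule that[of "\<lambda>n. fst (f n)" "\<lambda>n. snd (f n)"])
    have "0 < fst (f n)" for n using okf[of n] by (auto simp: ok_def split: prod.splits)
    moreover have "2 * fst (f (Suc n)) \<le> fst (f n)" for n using f[of n] by linarith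
    ultimately show "step_widths (\<lambda>n. fst (f n))" by unfold_locales
    show "snd (f k) * (2 * fst (f k) powr (1 - p)) \<le> e" "0 \<le> snd (f k)" for k
      using okf[of k] by (auto simp: ok_def split: prod.splits)
  qed (use f0 f in auto)
qed

proposition exists_smooth_step:
  fixes p e :: real
  assumes p: "0 < p" "p < 1" and e: "0 < e"
  obtains D :: "nat \<Rightarrow> real \<Rightarrow> real" where
    "\<And>k x. (D k has_vector_derivative D (Suc k) x) (at x)"
    "\<And>x. x \<le> 0 \<Longrightarrow> D 0 x = 0" "\<And>x. x > e \<Longrightarrow> D 0 x = 1" "\<And>x. 0 \<le> D 0 x \<and> D 0 x \<le> 1"
    "\<And>k. k \<ge> 1 \<Longrightarrow> Lp_int p (D k) \<le> ennreal e"
proof -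
  obtain w P where w: "step_widths w" "2 * w 0 \<le> e" and P: "P 0 = 1"
    "\<And>k. P (Suc k) = P k * (2 / w k powr p)" "\<And>k. P k * (2 * w k powr (1 - p)) \<le> e" "\<And>k. 0 \<le> P k"
    using exists_step_widths[OF p(2) e] by metis
  interpret step_widths w by fact
  \<comment> \<open>The induction starts at order 1 because the step itself equals 1 on a half-line.
    With \<open>k\<close> arbitrary, removing the outer difference quotient turns \<open>P k\<close>
    into \<open>P (Suc k)\<close>, so the same bound \<open>e\<close> passes through;
    \<open>k = 0\<close> gives the claim.\<close>
  have *: "ennreal (P k) * Lp_int p (step_deriv w (Suc n) k) \<le> ennreal e" for n k
  proof (induction n arbitrary: k)
    case 0
    have "ennreal (P k) * Lp_int p (step_deriv w (Suc 0) k) \<le> ennreal (P k) * ennreal (2 * w k powr (1 - p))"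
      by (intro mult_left_mono Lp_int_step_deriv_1 p) auto
    also have "\<dots> \<le> ennreal e" using P(3,4) by (simp flip: ennreal_mult add: ennreal_leI)
    finally show ?case .
  next
    case (Suc n)
    have "ennreal (P k) * Lp_int p (step_deriv w (Suc (Suc n)) k)
        \<le> ennreal (P k) * (ennreal (2 / w k powr p) * Lp_int p (step_deriv w (Suc n) (Suc k)))"
      using p by (intro mult_left_mono Lp_int_step_deriv_Suc) auto
    also have "\<dots> = ennreal (P (Suc k)) * Lp_int p (step_deriv w (Suc n) (Suc k))"
      unfolding P(2) ennreal_mult'[OF P(4)] by (simp only: mult.assoc)
    also have "\<dots> \<le> ennreal e" by (rule Suc)
    finally show ?case .
  qed
  show ?thesis
  proof (rule that[of "\<lambda>n. step_deriv w n 0"])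
    show "((\<lambda>x. step_deriv w k 0 x) has_vector_derivative step_deriv w (Suc k) 0 x) (at x)" for k x
      using DERIV_step_deriv by (simp add: has_real_derivative_iff_has_vector_derivative del: step_deriv.simps)
    show "Lp_int p (\<lambda>x. step_deriv w k 0 x) \<le> ennreal e" if "k \<ge> 1" for k
      using *[of 0 "k - 1"] that P(1) by (simp del: step_deriv.simps)
  qed (use step_fun_step_lim[of 0] w(2) in \<open>auto simp: step_fun_def\<close>)
qed

section \<open>Linear operations on smooth functions\<close>

lemma has_vector_derivative_nth_deriv:
  "smooth f \<Longrightarrow> (nth_deriv k f has_vector_derivative nth_deriv (Suc k) f x) (at x)"
  unfolding nth_deriv_Suc smooth_def using vector_derivative_works by blast

lemma borel_measurable_nth_deriv:
  fixes f :: "real \<Rightarrow> 'a::real_normed_vector"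
  assumes "smooth f"
  shows "nth_deriv k f \<in> borel_measurable lebesgue"
proof -
  have "continuous_on UNIV (nth_deriv k f)"
    using has_vector_derivative_continuous[OF has_vector_derivative_nth_deriv[OF assms]]
    by (auto simp: continuous_on_eq_continuous_at)
  then show ?thesis
    by (intro measurable_completion) (simp add: borel_measurable_continuous_onI)
qed

lemma
  assumes "smooth f" "smooth g"
  shows smooth_add: "smooth (\<lambda>x. f x + g x)"
    and nth_deriv_add: "nth_deriv k (\<lambda>x. f x + g x) = (\<lambda>x. nth_deriv k f x + nth_deriv k g x)"
  using smoothI_derivs[of "\<lambda>k x. nth_deriv k f x + nth_deriv k g x"] assms
  by (auto intro!: has_vector_derivative_add has_vector_derivative_nth_deriv)

lemma
  assumes "smooth f" "smooth g"
  shows smooth_diff: "smooth (\<lambda>x. f x - g x)"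
    and nth_deriv_diff: "nth_deriv k (\<lambda>x. f x - g x) = (\<lambda>x. nth_deriv k f x - nth_deriv k g x)"
  using smoothI_derivs[of "\<lambda>k x. nth_deriv k f x - nth_deriv k g x"] assms
  by (auto intro!: has_vector_derivative_diff has_vector_derivative_nth_deriv)

lemma
  assumes "smooth f" "bounded_linear L"
  shows smooth_linear: "smooth (\<lambda>x. L (f x))"
    and nth_deriv_linear: "nth_deriv k (\<lambda>x. L (f x)) = (\<lambda>x. L (nth_deriv k f x))"
  using smoothI_derivs[of "\<lambda>k x. L (nth_deriv k f x)"] assms
  by (auto intro!: bounded_linear.has_vector_derivative has_vector_derivative_nth_deriv)

section \<open>Approximation by functions with small derivatives\<close>

text \<open>One bound \<open>e\<close> serves all orders, so the notion does not involve the
  weights. Only \<open>\<phi> - f\<close> has to be small, which admits indicators of half-lines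
  although their p-integral is infinite.\<close>

definition flat_limit :: "real \<Rightarrow> (real \<Rightarrow> 'a::real_normed_vector) \<Rightarrow> bool" where
  "flat_limit p f \<longleftrightarrow> f \<in> borel_measurable lebesgue \<and>
     (\<forall>e>0. \<exists>\<phi>. smooth \<phi> \<and> Lp_int p (\<lambda>x. \<phi> x - f x) \<le> ennreal e \<and>
        (\<forall>k\<ge>1. Lp_int p (nth_deriv k \<phi>) \<le> ennreal e))"

lemma flat_limitD:
  assumes "flat_limit p f" "0 < e"
  obtains \<phi> where "smooth \<phi>" "Lp_int p (\<lambda>x. \<phi> x - f x) \<le> ennreal e"
    "\<And>k. k \<ge> 1 \<Longrightarrow> Lp_int p (nth_deriv k \<phi>) \<le> ennreal e"
  using assms unfolding flat_limit_def by blast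

lemma flat_limit_closed:
  fixes f :: "real \<Rightarrow> 'a::euclidean_space"
  assumes p: "0 < p" "p \<le> 1" and f [measurable]: "f \<in> borel_measurable lebesgue"
    and ex: "\<And>e. 0 < e \<Longrightarrow> \<exists>g. flat_limit p g \<and> Lp_int p (\<lambda>x. g x - f x) \<le> ennreal e"
  shows "flat_limit p f"
  unfolding flat_limit_def
proof (intro conjI allI impI f)
  fix e :: real assume e: "0 < e"
  obtain g where g: "flat_limit p g" "Lp_int p (\<lambda>x. g x - f x) \<le> ennreal (e / 2)"
    using ex[of "e / 2"] e by auto
  obtain \<phi> where \<phi>: "smooth \<phi>" "Lp_int p (\<lambda>x. \<phi> x - g x) \<le> ennreal (e / 2)"
    "\<And>k. k \<ge> 1 \<Longrightarrow> Lp_int p (nth_deriv k \<phi>) \<le> ennreal (e / 2)"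
    using flat_limitD[OF g(1), of "e / 2"] e by auto
  have "Lp_int p (\<lambda>x. \<phi> x - f x) \<le> Lp_int p (\<lambda>x. \<phi> x - g x) + Lp_int p (\<lambda>x. g x - f x)"
    using borel_measurable_nth_deriv[OF \<phi>(1), of 0] g(1) p
    by (intro Lp_int_triangle) (auto simp: flat_limit_def)
  also have "\<dots> \<le> ennreal (e / 2) + ennreal (e / 2)" by (intro add_mono \<phi> g)
  also have "\<dots> = ennreal e" using e by (simp flip: ennreal_plus)
  finally show "\<exists>\<phi>. smooth \<phi> \<and> Lp_int p (\<lambda>x. \<phi> x - f x) \<le> ennreal e \<and>
        (\<forall>k\<ge>1. Lp_int p (nth_deriv k \<phi>) \<le> ennreal e)"
    using \<phi>(1) order_trans[OF \<phi>(3) ennreal_leI[of "e / 2" e]] e by (intro exI[of _ \<phi>]) auto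
qed

lemma flat_limit_AE_cong:
  fixes f g :: "real \<Rightarrow> 'a::euclidean_space"
  assumes p: "0 < p" "p \<le> 1" and f: "flat_limit p f"
    and g: "g \<in> borel_measurable lebesgue" "AE x in lebesgue. f x = g x"
  shows "flat_limit p g"
proof (rule flat_limit_closed[OF p g(1)])
  have "Lp_int p (\<lambda>x. f x - g x) = Lp_int p (\<lambda>x. 0 :: 'a)"
    unfolding Lp_int_def using g(2) by (intro nn_integral_cong_AE) auto
  then show "\<exists>g'. flat_limit p g' \<and> Lp_int p (\<lambda>x. g' x - g x) \<le> ennreal e" for e
    using f by auto
qed

lemma flat_limit_add:
  fixes f g :: "real \<Rightarrow> 'a::euclidean_space"
  assumes p: "0 < p" "p \<le> 1" and f: "flat_limit p f" and g: "flat_limit p g"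
  shows "flat_limit p (\<lambda>x. f x + g x)"
  unfolding flat_limit_def
proof (intro conjI allI impI)
  have fg [measurable]: "f \<in> borel_measurable lebesgue" "g \<in> borel_measurable lebesgue"
    using f g by (auto simp: flat_limit_def)
  show "(\<lambda>x. f x + g x) \<in> borel_measurable lebesgue" by measurable
  fix e :: real assume e: "0 < e"
  obtain \<phi> where \<phi>: "smooth \<phi>" "Lp_int p (\<lambda>x. \<phi> x - f x) \<le> ennreal (e / 2)"
    "\<And>k. k \<ge> 1 \<Longrightarrow> Lp_int p (nth_deriv k \<phi>) \<le> ennreal (e / 2)"
    using flat_limitD[OF f, of "e / 2"] e by auto
  obtain \<psi> where \<psi>: "smooth \<psi>" "Lp_int p (\<lambda>x. \<psi> x - g x) \<le> ennreal (e / 2)"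
    "\<And>k. k \<ge> 1 \<Longrightarrow> Lp_int p (nth_deriv k \<psi>) \<le> ennreal (e / 2)"
    using flat_limitD[OF g, of "e / 2"] e by auto
  have m [measurable]: "nth_deriv k \<phi> \<in> borel_measurable lebesgue" "nth_deriv k \<psi> \<in> borel_measurable lebesgue" for k
    using \<phi>(1) \<psi>(1) by (auto intro: borel_measurable_nth_deriv)
  have ee: "ennreal (e / 2) + ennreal (e / 2) = ennreal e" using e by (simp flip: ennreal_plus)
  have "Lp_int p (\<lambda>x. (\<phi> x - f x) + (\<psi> x - g x)) \<le> Lp_int p (\<lambda>x. \<phi> x - f x) + Lp_int p (\<lambda>x. \<psi> x - g x)"
    using m[of 0] p by (intro Lp_int_add_le) auto
  also have "\<dots> \<le> ennreal e" unfolding ee[symmetric] by (intro add_mono \<phi> \<psi>)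
  finally have 1: "Lp_int p (\<lambda>x. (\<phi> x + \<psi> x) - (f x + g x)) \<le> ennreal e" by (simp add: algebra_simps)
  have 2: "Lp_int p (nth_deriv k (\<lambda>x. \<phi> x + \<psi> x)) \<le> ennreal e" if "k \<ge> 1" for k
  proof -
    have "Lp_int p (nth_deriv k (\<lambda>x. \<phi> x + \<psi> x)) \<le> Lp_int p (nth_deriv k \<phi>) + Lp_int p (nth_deriv k \<psi>)"
      unfolding nth_deriv_add[OF \<phi>(1) \<psi>(1)] using p by (intro Lp_int_add_le m)
    also have "\<dots> \<le> ennreal e" unfolding ee[symmetric] by (intro add_mono \<phi> \<psi> that)
    finally show ?thesis .
  qed
  show "\<exists>\<phi>. smooth \<phi> \<and> Lp_int p (\<lambda>x. \<phi> x - (f x + g x)) \<le> ennreal e \<and>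
        (\<forall>k\<ge>1. Lp_int p (nth_deriv k \<phi>) \<le> ennreal e)"
    using smooth_add[OF \<phi>(1) \<psi>(1)] 1 2 by blast
qed

text \<open>Two instances matter: \<open>uminus\<close> for differences, and multiples of a fixed
  vector, which carry real indicators over to vector-valued simple functions.\<close>

lemma flat_limit_linear:
  fixes f :: "real \<Rightarrow> 'a::euclidean_space" and L :: "'a \<Rightarrow> 'b::euclidean_space"
  assumes p: "0 < p" and f: "flat_limit p f" and L: "bounded_linear L"
  shows "flat_limit p (\<lambda>x. L (f x))"
  unfolding flat_limit_def
proof (intro conjI allI impI)
  interpret bounded_linear L by fact
  have fm [measurable]: "f \<in> borel_measurable lebesgue"
    using f by (auto simp: flat_limit_def)
  show "(\<lambda>x. L (f x)) \<in> borel_measurable lebesgue"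
    by (rule measurable_compose[OF fm]) (intro borel_measurable_continuous_onI continuous_on continuous_on_id)
  fix e :: real assume e: "0 < e"
  obtain K where K: "0 < K" "\<And>x. norm (L x) \<le> norm x * K" using pos_bounded by blast
  define d where "d = e / K powr p"
  have d: "0 < d" using e K by (simp add: d_def)
  obtain \<phi> where \<phi>: "smooth \<phi>" "Lp_int p (\<lambda>x. \<phi> x - f x) \<le> ennreal d"
    "\<And>k. k \<ge> 1 \<Longrightarrow> Lp_int p (nth_deriv k \<phi>) \<le> ennreal d"
    using flat_limitD[OF f d] by auto
  have b: "Lp_int p (\<lambda>x. L (h x)) \<le> ennreal e" if h: "h \<in> borel_measurable lebesgue" "Lp_int p h \<le> ennreal d" for h
  proof -
    have "Lp_int p (\<lambda>x. L (h x)) \<le> Lp_int p (\<lambda>x. K *\<^sub>R h x)"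
      using K p by (intro Lp_int_mono) (auto simp: mult.commute)
    also have "\<dots> = ennreal (K powr p) * Lp_int p h"
      using K by (intro Lp_int_cmult h) auto
    also have "\<dots> \<le> ennreal (K powr p) * ennreal d" by (intro mult_left_mono h) auto
    also have "\<dots> = ennreal e" using K d by (simp add: d_def flip: ennreal_mult)
    finally show ?thesis .
  qed
  have "Lp_int p (\<lambda>x. L (\<phi> x) - L (f x)) \<le> ennreal e"
    using b[of "\<lambda>x. \<phi> x - f x"] \<phi>(2) borel_measurable_nth_deriv[OF \<phi>(1), of 0] by (simp add: diff)
  moreover have "Lp_int p (nth_deriv k (\<lambda>x. L (\<phi> x))) \<le> ennreal e" if "k \<ge> 1" for k
    unfolding nth_deriv_linear[OF \<phi>(1) L] using that by (intro b \<phi> borel_measurable_nth_deriv)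
  ultimately show "\<exists>\<phi>. smooth \<phi> \<and> Lp_int p (\<lambda>x. \<phi> x - L (f x)) \<le> ennreal e \<and>
        (\<forall>k\<ge>1. Lp_int p (nth_deriv k \<phi>) \<le> ennreal e)"
    using smooth_linear[OF \<phi>(1) L] by blast
qed

lemma flat_limit_diff:
  fixes f g :: "real \<Rightarrow> 'a::euclidean_space"
  assumes p: "0 < p" "p \<le> 1" and "flat_limit p f" "flat_limit p g"
  shows "flat_limit p (\<lambda>x. f x - g x)"
  using flat_limit_add[OF p assms(3) flat_limit_linear[OF p(1) assms(4), of uminus]]
  by (simp add: bounded_linear_minus bounded_linear_ident)

lemma flat_limit_zero: "0 < p \<Longrightarrow> flat_limit p (\<lambda>x. 0 :: 'a::euclidean_space)"
proof -
  have "smooth (\<lambda>x. 0 :: 'a)" "nth_deriv k (\<lambda>x. 0 :: 'a) = (\<lambda>x. 0)" for k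
    using smoothI_derivs[of "\<lambda>k x. 0 :: 'a"] by auto
  then show ?thesis unfolding flat_limit_def by auto
qed

lemma flat_limit_sum:
  fixes f :: "nat \<Rightarrow> real \<Rightarrow> 'a::euclidean_space"
  assumes "0 < p" "p \<le> 1" "\<And>i. flat_limit p (f i)"
  shows "flat_limit p (\<lambda>x. \<Sum>i<n. f i x)"
  by (induction n) (auto intro: flat_limit_add flat_limit_zero assms)

text \<open>The translated smooth step differs from the indicator by at most 1, and only on an
  interval of length \<open>e\<close>; its derivatives are small by construction.\<close>

lemma flat_limit_greaterThan:
  assumes p: "0 < p" "p < 1"
  shows "flat_limit p (indicat_real {a<..})"
  unfolding flat_limit_def
proof (intro conjI allI impI)
  fix e :: real assume e: "0 < e"
  obtain D :: "nat \<Rightarrow> real \<Rightarrow> real" where D: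
    "\<And>k x. (D k has_vector_derivative D (Suc k) x) (at x)"
    "\<And>x. x \<le> 0 \<Longrightarrow> D 0 x = 0" "\<And>x. x > e \<Longrightarrow> D 0 x = 1" "\<And>x. 0 \<le> D 0 x \<and> D 0 x \<le> 1"
    "\<And>k. k \<ge> 1 \<Longrightarrow> Lp_int p (D k) \<le> ennreal e"
    using exists_smooth_step[OF p e] by metis
  have der: "((\<lambda>x. D k (x - a)) has_vector_derivative D (Suc k) (x - a)) (at x)" for k x
    using DERIV_shift[of "D k" "D (Suc k) (x - a)" x "- a"] D(1)[of k "x - a"]
    by (simp add: has_real_derivative_iff_has_vector_derivative)
  have s: "smooth (\<lambda>x. D 0 (x - a))" "nth_deriv k (\<lambda>x. D 0 (x - a)) = (\<lambda>x. D k (x - a))" for k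
    using smoothI_derivs[of "\<lambda>k x. D k (x - a)", OF der] by auto
  have "smooth (D 0)" "nth_deriv k (D 0) = D k" for k using smoothI_derivs[of D, OF D(1)] by auto
  then have "D k \<in> borel_measurable lebesgue" for k by (metis borel_measurable_nth_deriv)
  then have "Lp_int p (\<lambda>x. D k (x - a)) = Lp_int p (D k)" for k by (rule Lp_int_shift)
  moreover have "Lp_int p (\<lambda>x. D 0 (x - a) - indicat_real {a<..} x) \<le> ennreal (1 powr p * ((a + e) - a))"
  proof (rule Lp_int_bounded_support)
    show "D 0 (x - a) - indicat_real {a<..} x = 0" if "x \<notin> {a..a + e}" for x
      using that D(2,3)[of "x - a"] e by (auto simp: indicator_def)
    show "norm (D 0 (x - a) - indicat_real {a<..} x) \<le> 1" for x
      using D(4)[of "x - a"] by (auto simp: indicator_def)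
  qed (use e p in auto)
  ultimately show "\<exists>\<phi>. smooth \<phi> \<and> Lp_int p (\<lambda>x. \<phi> x - indicat_real {a<..} x) \<le> ennreal e \<and>
        (\<forall>k\<ge>1. Lp_int p (nth_deriv k \<phi>) \<le> ennreal e)"
    using s D(5) by (intro exI[of _ "\<lambda>x. D 0 (x - a)"]) auto
qed (simp add: borel_measurable_indicator)

lemma flat_limit_greaterThanAtMost:
  assumes p: "0 < p" "p < 1"
  shows "flat_limit p (indicat_real {a<..b})"
proof -
  \<comment> \<open>Taking \<open>max a b\<close> keeps the identity true when \<open>b < a\<close>
    and the interval is empty.\<close>
  have "indicat_real {a<..b} = (\<lambda>x. indicat_real {a<..} x - indicat_real {max a b<..} x)"
    by (auto simp: indicator_def fun_eq_iff)
  then show ?thesis using p by (auto intro!: flat_limit_diff flat_limit_greaterThan)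
qed

section \<open>From intervals to measurable sets of finite measure\<close>

lemma Lp_int_indicator:
  assumes "0 < p" "A \<in> sets lebesgue" "\<And>x. norm (f x) = indicator A x"
  shows "Lp_int p f = emeasure lebesgue A"
proof -
  have "Lp_int p f = (\<integral>\<^sup>+ x. indicator A x \<partial>lebesgue)"
    unfolding Lp_int_def assms(3) by (intro nn_integral_cong) (auto simp: indicator_def)
  then show ?thesis using assms by simp
qed

text \<open>For nested sets the p-integral of the difference of indicators is the measure of
  \<open>B - A n\<close>, which decreases to 0 by continuity from above, since \<open>B\<close> has
  finite measure.\<close>

lemma flat_limit_indicator_incseq:
  assumes p: "0 < p" "p \<le> 1" and B: "B \<in> sets lebesgue"
    and A: "\<And>n. flat_limit p (indicat_real (A n))" "\<And>n. A n \<subseteq> A (Suc n)" "(\<Union>n. A n) = B"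
    and fin: "emeasure lebesgue B < \<infinity>"
  shows "flat_limit p (indicat_real B)"
proof (rule flat_limit_closed[OF p])
  show "indicat_real B \<in> borel_measurable lebesgue" using B by simp
  have Am [measurable]: "A n \<in> sets lebesgue" for n
    using A(1)[of n] by (auto simp: flat_limit_def borel_measurable_indicator_iff)
  have "(\<lambda>n. emeasure lebesgue (B - A n)) \<longlonglongrightarrow> emeasure lebesgue (\<Inter>n. B - A n)"
  proof (rule Lim_emeasure_decseq)
    show "range (\<lambda>n. B - A n) \<subseteq> sets lebesgue" using B by auto
    show "decseq (\<lambda>n. B - A n)" using A(2) by (intro decseq_SucI) auto
    have "emeasure lebesgue (B - A n) \<le> emeasure lebesgue B" for n
      using B by (intro emeasure_mono) auto
    then show "emeasure lebesgue (B - A n) \<noteq> \<infinity>" for n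
      using fin by (metis infinity_ennreal_def leD)
  qed
  moreover have e: "(\<Inter>n. B - A n) = {}" using A(3) by auto
  ultimately have lim: "(\<lambda>n. emeasure lebesgue (B - A n)) \<longlonglongrightarrow> 0"
    unfolding e by simp
  fix e :: real assume "0 < e"
  then have "eventually (\<lambda>n. emeasure lebesgue (B - A n) < ennreal e) sequentially"
    using lim by (intro order_tendstoD) auto
  then obtain n where n: "emeasure lebesgue (B - A n) < ennreal e"
    by (auto simp: eventually_sequentially)
  have "A n \<subseteq> B" using A(3) by auto
  then have "Lp_int p (\<lambda>x. indicat_real (A n) x - indicat_real B x) = emeasure lebesgue (B - A n)"
    using p B by (intro Lp_int_indicator) (auto simp: indicator_def)
  then show "\<exists>g. flat_limit p g \<and> Lp_int p (\<lambda>x. g x - indicat_real B x) \<le> ennreal e"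
    using A(1)[of n] n by (intro exI[of _ "indicat_real (A n)"]) auto
qed

text \<open>Induction over the Borel sets from the intersection-stable generator of closed
  half-lines. The bounded window turns generators into half-open intervals and keeps the measures
  finite in the step for countable unions.\<close>

lemma flat_limit_indicator_Int_window:
  assumes p: "0 < p" "p < 1" and A: "A \<in> sets borel"
  shows "flat_limit p (indicat_real (A \<inter> {-c<..c}))"
proof -
  have p1: "p \<le> 1" using p by simp
  let ?G = "range (\<lambda>a. {..a::real})"
  have bo: "(borel :: real measure) = sigma UNIV ?G" by (rule borel_eq_atMost)
  have "Int_stable ?G" by (auto simp: Int_stable_def)
  moreover have "?G \<subseteq> Pow UNIV" by simp
  moreover have sg: "sets borel = sigma_sets UNIV ?G" unfolding bo by (simp add: sets_measure_of)
  then have "A \<in> sigma_sets UNIV ?G" using A by simp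
  ultimately show ?thesis
  proof (induction rule: sigma_sets_induct_disjoint)
    case (basic A)
    then obtain a where "A = {..a}" by auto
    then have "A \<inter> {-c<..c} = {-c<..min a c}" by auto
    then show ?case using flat_limit_greaterThanAtMost[OF p] by simp
  next
    case empty
    then show ?case using flat_limit_zero p by simp
  next
    case (compl A)
    have "indicat_real ((UNIV - A) \<inter> {-c<..c}) = (\<lambda>x. indicat_real {-c<..c} x - indicat_real (A \<inter> {-c<..c}) x)"
      by (auto simp: indicator_def fun_eq_iff)
    then show ?case using flat_limit_diff[OF p(1) p1 flat_limit_greaterThanAtMost[OF p] compl(2)] by simp
  next
    case (union A)
    show ?case
    proof (rule flat_limit_indicator_incseq[OF p(1) p1])
      have "A i \<in> sets borel" for i using union(2) sg by auto
      then show "\<Union> (range A) \<inter> {-c<..c} \<in> sets lebesgue" by auto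
      have "emeasure lebesgue (\<Union> (range A) \<inter> {-c<..c}) \<le> emeasure lebesgue {-c<..c}"
        by (intro emeasure_mono) auto
      also have "\<dots> < \<infinity>" using emeasure_bounded_finite[of "{-c<..c}"] by simp
      finally show "emeasure lebesgue (\<Union> (range A) \<inter> {-c<..c}) < \<infinity>" .
      \<comment> \<open>By disjointness the indicators of the partial unions are finite sums, and
        these partial unions form the increasing sequence required by
        \<open>flat_limit_indicator_incseq\<close>.\<close>
      have "indicat_real ((\<Union>i<n. A i) \<inter> {-c<..c}) = (\<lambda>x. \<Sum>i<n. indicat_real (A i \<inter> {-c<..c}) x)" for n
      proof (induction n)
        case (Suc n)
        have "A n \<inter> (\<Union>i<n. A i) = {}"
        proof -
          have "A n \<inter> A i = {}" if "i < n" for i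
            using that by (intro disjoint_family_onD[OF union(1)]) auto
          then show ?thesis by auto
        qed
        then have "indicat_real ((\<Union>i<Suc n. A i) \<inter> {-c<..c}) =
            (\<lambda>x. indicat_real ((\<Union>i<n. A i) \<inter> {-c<..c}) x + indicat_real (A n \<inter> {-c<..c}) x)"
          unfolding lessThan_Suc UN_insert Int_Un_distrib2
          by (intro ext, subst indicator_add[symmetric]) (auto simp: add.commute)
        then show ?case by (simp add: Suc)
      qed auto
      then show "flat_limit p (indicat_real ((\<Union>i<n. A i) \<inter> {-c<..c}))" for n
        using flat_limit_sum[OF p(1) p1 union(3)] by simp
      show "(\<Union>i<n. A i) \<inter> {-c<..c} \<subseteq> (\<Union>i<Suc n. A i) \<inter> {-c<..c}" for n
        by (auto intro: less_SucI)
      show "(\<Union>n. (\<Union>i<n. A i) \<inter> {-c<..c}) = \<Union> (range A) \<inter> {-c<..c}" by auto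
    qed
  qed
qed

text \<open>A Lebesgue set is a Borel set up to a null set, and the Borel set is exhausted by
  windows of growing size.\<close>

lemma flat_limit_indicator:
  assumes p: "0 < p" "p < 1" and A: "A \<in> sets lebesgue" "emeasure lebesgue A < \<infinity>"
  shows "flat_limit p (indicat_real A)"
proof -
  obtain S N N' where N: "A = S \<union> N" "N \<subseteq> N'" "N' \<in> null_sets lborel" "S \<in> sets lborel"
    using A(1) by (rule sets_completionE)
  have S: "S \<in> sets borel" "S \<in> sets lebesgue" using N(4) by auto
  have "flat_limit p (indicat_real S)"
  proof (rule flat_limit_indicator_incseq)
    show "flat_limit p (indicat_real (S \<inter> {-real n<..real n}))" for n
      using flat_limit_indicator_Int_window[OF p S(1)] .
    show "S \<inter> {-real n<..real n} \<subseteq> S \<inter> {-real (Suc n)<..real (Suc n)}" for n by auto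
    have "\<exists>n. -real n < x \<and> x \<le> real n" for x
      using reals_Archimedean2[of "\<bar>x\<bar>"] by (metis abs_less_iff less_imp_le neg_less_iff_less minus_minus)
    then show "(\<Union>n. S \<inter> {-real n<..real n}) = S" by auto
    have "emeasure lebesgue S \<le> emeasure lebesgue A" using A N S by (intro emeasure_mono) auto
    then show "emeasure lebesgue S < \<infinity>" using A(2) by simp
  qed (use p S in auto)
  then show ?thesis
  proof (rule flat_limit_AE_cong[rotated 2])
    have "N' \<in> null_sets lebesgue" using N(3) by (rule null_sets_completionI)
    then have "AE x in lebesgue. x \<notin> N'" by (rule AE_not_in)
    then show "AE x in lebesgue. indicat_real S x = indicat_real A x"
      using N(1,2) by (auto simp: indicator_def elim!: eventually_mono)
  qed (use p A in auto)
qed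

text \<open>Simple functions with \<open>norm (s i x) \<le> 2 * norm (f x)\<close> converge
  pointwise to \<open>f\<close>; the error is at most \<open>3 * norm (f x)\<close>, so dominated
  convergence applies to the p-th powers.\<close>

proposition flat_limit_Lp:
  fixes f :: "real \<Rightarrow> 'a::euclidean_space"
  assumes p: "0 < p" "p < 1" and f [measurable]: "f \<in> borel_measurable lebesgue"
    and fin: "Lp_int p f < \<infinity>"
  shows "flat_limit p f"
proof -
  have p1: "p \<le> 1" using p by simp
  obtain s where s: "\<And>i. simple_function lebesgue (s i)" "\<And>x. (\<lambda>i. s i x) \<longlonglongrightarrow> f x"
    "\<And>i x. norm (s i x) \<le> 2 * norm (f x)"
    using borel_measurable_implies_sequence_metric[OF f, of 0] by (auto simp: dist_norm)
  have sm [measurable]: "s i \<in> borel_measurable lebesgue" for i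
    using s(1) by (rule borel_measurable_simple_function)
  have fl: "flat_limit p (s i)" for i
  proof -
    have "Lp_int p (s i) \<le> Lp_int p (\<lambda>x. 2 *\<^sub>R f x)"
      using s(3) p by (intro Lp_int_mono) auto
    also have "\<dots> = ennreal (2 powr p) * Lp_int p f" by (intro Lp_int_cmult f) auto
    also have "\<dots> < \<infinity>" using fin by (simp add: ennreal_mult_less_top)
    finally have fin': "Lp_int p (s i) < \<infinity>" .
    \<comment> \<open>A simple function takes finitely many values, so its nonzero values have norm
      at least some \<open>d > 0\<close>; a support of infinite measure would make the p-integral
      infinite. Finite support is what the induction over simple functions asks for.\<close>
    have "emeasure lebesgue {x \<in> space lebesgue. s i x \<noteq> 0} \<noteq> \<infinity>"
    proof
      assume inf: "emeasure lebesgue {x \<in> space lebesgue. s i x \<noteq> 0} = \<infinity>"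
      have "finite (s i ` UNIV)" using simple_functionD(1)[OF s(1)] by simp
      then obtain d where d: "d > 0" "\<And>x. s i x \<noteq> 0 \<Longrightarrow> d \<le> norm (s i x)"
      proof -
        assume fin: "finite (s i ` UNIV)" and th: "\<And>d. 0 < d \<Longrightarrow> (\<And>x. s i x \<noteq> 0 \<Longrightarrow> d \<le> norm (s i x)) \<Longrightarrow> thesis"
        \<comment> \<open>The inserted 1 keeps the minimum defined when \<open>s i\<close> vanishes
          everywhere.\<close>
        define V where "V = insert 1 (norm ` (s i ` UNIV - {0}))"
        have V: "finite V" "V \<noteq> {}" using fin by (auto simp: V_def)
        show thesis
        proof (rule th[of "Min V"])
          show "0 < Min V" using V by (subst Min_gr_iff) (auto simp: V_def)
          show "Min V \<le> norm (s i x)" if "s i x \<noteq> 0" for x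
            using V that by (intro Min_le) (auto simp: V_def)
        qed
      qed
      have "ennreal (d powr p) * emeasure lebesgue {x \<in> space lebesgue. s i x \<noteq> 0} =
          (\<integral>\<^sup>+ x. ennreal (d powr p) * indicator {x \<in> space lebesgue. s i x \<noteq> 0} x \<partial>lebesgue)"
        by (subst nn_integral_cmult_indicator) measurable
      also have "\<dots> \<le> Lp_int p (s i)"
        unfolding Lp_int_def using d p
        by (intro nn_integral_mono) (auto simp: indicator_def intro!: ennreal_leI powr_mono2)
      finally show False using fin' inf d(1) by (simp add: ennreal_mult_top)
    qed
    with s(1)[of i] show ?thesis
    proof (induction rule: integrable_simple_function_induct)
      case (cong f g)
      then show ?case by (simp add: fun_eq_iff[symmetric])
    next
      case (indicator A y)
      have "bounded_linear (\<lambda>r::real. r *\<^sub>R y)" by (rule bounded_linear_scaleR_left)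
      then show ?case
        using flat_limit_linear[OF p(1) flat_limit_indicator[OF p indicator]] by blast
    next
      case (add f g)
      then show ?case using flat_limit_add[OF p(1) p1] by blast
    qed
  qed
  have "(\<lambda>i. Lp_int p (\<lambda>x. s i x - f x)) \<longlonglongrightarrow> (\<integral>\<^sup>+ x. 0 \<partial>(lebesgue :: real measure))"
    unfolding Lp_int_def
  proof (rule nn_integral_dominated_convergence)
    show "(\<integral>\<^sup>+ x. ennreal (3 powr p) * ennreal (norm (f x) powr p) \<partial>lebesgue) < \<infinity>"
      using fin by (subst nn_integral_cmult) (auto simp: Lp_int_def ennreal_mult_less_top)
    show "AE x in lebesgue. ennreal (norm (s i x - f x) powr p) \<le> ennreal (3 powr p) * ennreal (norm (f x) powr p)" for i
    proof (intro AE_I2)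
      fix x
      have "norm (s i x - f x) \<le> 3 * norm (f x)"
        using norm_triangle_ineq4[of "s i x" "f x"] s(3)[of i x] by linarith
      then have "norm (s i x - f x) powr p \<le> (3 * norm (f x)) powr p" using p by (intro powr_mono2) auto
      then show "ennreal (norm (s i x - f x) powr p) \<le> ennreal (3 powr p) * ennreal (norm (f x) powr p)"
        by (simp add: powr_mult ennreal_leI flip: ennreal_mult)
    qed
    show "AE x in lebesgue. (\<lambda>i. ennreal (norm (s i x - f x) powr p)) \<longlonglongrightarrow> 0"
    proof (intro AE_I2)
      fix x
      have "(\<lambda>i. norm (s i x - f x) powr p) \<longlonglongrightarrow> 0 powr p"
        using tendsto_norm[OF tendsto_diff[OF s(2)[of x] tendsto_const[of "f x"]]] p
        by (intro tendsto_powr') auto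
      then show "(\<lambda>i. ennreal (norm (s i x - f x) powr p)) \<longlonglongrightarrow> 0"
        using tendsto_ennrealI by fastforce
    qed
  qed auto
  then have lim: "(\<lambda>i. Lp_int p (\<lambda>x. s i x - f x)) \<longlonglongrightarrow> 0" by simp
  show ?thesis
  proof (rule flat_limit_closed[OF p(1) p1 f])
    fix e :: real assume "0 < e"
    then have "eventually (\<lambda>i. Lp_int p (\<lambda>x. s i x - f x) < ennreal e) sequentially"
      using lim by (intro order_tendstoD) auto
    then show "\<exists>g. flat_limit p g \<and> Lp_int p (\<lambda>x. g x - f x) \<le> ennreal e"
      using fl by (auto simp: eventually_sequentially intro: less_imp_le)
  qed
qed

section \<open>The completion\<close>

lemma Lp_norm_eq:
  "Lp_norm p f = (if Lp_int p f = \<infinity> then \<infinity> else ennreal (enn2real (Lp_int p f) powr (1 / p)))"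
  by (simp add: Lp_norm_def Lp_int_def Let_def)

lemma Lp_norm_le_iff:
  assumes "0 < p" "0 \<le> e"
  shows "Lp_norm p f \<le> ennreal e \<longleftrightarrow> Lp_int p f \<le> ennreal (e powr p)"
proof (cases "Lp_int p f")
  case (real r)
  have "r powr (1 / p) \<le> e \<longleftrightarrow> r \<le> e powr p"
  proof
    assume "r powr (1 / p) \<le> e"
    then have "(r powr (1 / p)) powr p \<le> e powr p" using assms by (intro powr_mono2) auto
    then show "r \<le> e powr p" using assms real by (simp add: powr_powr)
  next
    assume "r \<le> e powr p"
    then have "r powr (1 / p) \<le> (e powr p) powr (1 / p)" using assms real by (intro powr_mono2) auto
    then show "r powr (1 / p) \<le> e" using assms by (simp add: powr_powr)
  qed
  then show ?thesis using real assms by (simp add: Lp_norm_eq)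
qed (simp add: Lp_norm_eq top_unique)

lemma Lp_norm_finite_iff: "Lp_norm p f < \<infinity> \<longleftrightarrow> Lp_int p f < \<infinity>"
  by (cases "Lp_int p f = \<infinity>") (simp_all add: Lp_norm_eq less_top)

lemma Lp_fun_iff: "f \<in> Lp_fun p \<longleftrightarrow> f \<in> borel_measurable lebesgue \<and> Lp_int p f < \<infinity>"
  by (simp add: Lp_fun_def Lp_norm_finite_iff[unfolded infinity_ennreal_def])

lemma Lp_fun_measurable: "f \<in> Lp_fun p \<Longrightarrow> f \<in> borel_measurable lebesgue"
  by (simp add: Lp_fun_iff)

lemma tendsto_Lp_norm:
  assumes p: "0 < p" and lim: "(\<lambda>i. Lp_int p (F i)) \<longlonglongrightarrow> Lp_int p f" and fin: "Lp_int p f < \<infinity>"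
  shows "(\<lambda>i. Lp_norm p (F i)) \<longlonglongrightarrow> Lp_norm p f"
proof -
  have ne: "Lp_int p f \<noteq> top" using fin by simp
  have "(\<lambda>i. enn2real (Lp_int p (F i))) \<longlonglongrightarrow> enn2real (Lp_int p f)"
    using lim fin by (intro tendsto_enn2real) (auto simp: less_top)
  then have "(\<lambda>i. enn2real (Lp_int p (F i)) powr (1 / p)) \<longlonglongrightarrow> enn2real (Lp_int p f) powr (1 / p)"
    using p by (intro tendsto_powr') auto
  then have *: "(\<lambda>i. ennreal (enn2real (Lp_int p (F i)) powr (1 / p))) \<longlonglongrightarrow> Lp_norm p f"
    using ne by (simp add: Lp_norm_eq tendsto_ennrealI)
  \<comment> \<open>Early terms may be infinite, where \<open>enn2real\<close> returns 0; the real
    formula agrees with \<open>Lp_norm\<close> only from some index on.\<close>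
  have "eventually (\<lambda>i. Lp_int p (F i) < \<infinity>) sequentially"
    using lim fin by (rule order_tendstoD)
  then have "eventually (\<lambda>i. ennreal (enn2real (Lp_int p (F i)) powr (1 / p)) = Lp_norm p (F i)) sequentially"
    by eventually_elim (simp add: Lp_norm_eq)
  from tendsto_cong[OF this] show ?thesis using * by simp
qed

lemma tendsto_0_ennreal_iff:
  fixes X :: "nat \<Rightarrow> ennreal"
  shows "X \<longlonglongrightarrow> 0 \<longleftrightarrow> (\<forall>e>0. \<forall>\<^sub>F i in sequentially. X i \<le> ennreal e)"
proof
  assume "X \<longlonglongrightarrow> 0"
  then have "\<forall>\<^sub>F i in sequentially. X i < ennreal e" if "0 < e" for e
    using that by (intro order_tendstoD) auto
  then show "\<forall>e>0. \<forall>\<^sub>F i in sequentially. X i \<le> ennreal e"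
    by (blast intro: eventually_mono less_imp_le)
next
  assume *: "\<forall>e>0. \<forall>\<^sub>F i in sequentially. X i \<le> ennreal e"
  show "X \<longlonglongrightarrow> 0"
  proof (rule order_tendstoI)
    fix a :: ennreal assume "0 < a"
    obtain e where "0 < e" "ennreal e < a"
    proof (cases a)
      case (real r)
      then show ?thesis using that[of "r / 2"] \<open>0 < a\<close> by (auto simp: ennreal_less_iff)
    qed (use that[of 1] in auto)
    then show "\<forall>\<^sub>F i in sequentially. X i < a"
      using * by (auto elim!: eventually_mono)
  qed simp
qed

lemma tendsto_Lp_norm_0_iff:
  assumes "0 < p"
  shows "(\<lambda>i. Lp_norm p (F i)) \<longlonglongrightarrow> 0 \<longleftrightarrow> (\<lambda>i. Lp_int p (F i)) \<longlonglongrightarrow> 0"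
proof
  assume n: "(\<lambda>i. Lp_norm p (F i)) \<longlonglongrightarrow> 0"
  show "(\<lambda>i. Lp_int p (F i)) \<longlonglongrightarrow> 0"
    unfolding tendsto_0_ennreal_iff
  proof (intro allI impI)
    fix e :: real assume e: "0 < e"
    then have "\<forall>\<^sub>F i in sequentially. Lp_norm p (F i) \<le> ennreal (e powr (1 / p))"
      using n unfolding tendsto_0_ennreal_iff by simp
    then show "\<forall>\<^sub>F i in sequentially. Lp_int p (F i) \<le> ennreal e"
      using assms e by (simp add: Lp_norm_le_iff powr_powr)
  qed
next
  assume "(\<lambda>i. Lp_int p (F i)) \<longlonglongrightarrow> 0"
  then have "(\<lambda>i. Lp_norm p (F i)) \<longlonglongrightarrow> Lp_norm p (\<lambda>x. 0 :: 'a)"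
    using assms by (intro tendsto_Lp_norm) auto
  then show "(\<lambda>i. Lp_norm p (F i)) \<longlonglongrightarrow> 0" by (simp add: Lp_norm_eq)
qed

lemma tendsto_0_le_add_ennreal:
  fixes X Y Z :: "nat \<Rightarrow> ennreal"
  assumes "X \<longlonglongrightarrow> 0" "Y \<longlonglongrightarrow> 0" "\<And>i. Z i \<le> X i + Y i"
  shows "Z \<longlonglongrightarrow> 0"
proof (rule tendsto_sandwich[of "\<lambda>_. 0" Z _ "\<lambda>i. X i + Y i"])
  show "(\<lambda>i. X i + Y i) \<longlonglongrightarrow> 0" using tendsto_add[OF assms(1,2)] by simp
qed (use assms in auto)

text \<open>The reverse triangle inequality for p-th powers encloses \<open>Lp_int p (F i)\<close>
  between \<open>Lp_int p f\<close> minus and plus the error; the subtraction in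
  \<open>ennreal\<close> is harmless because \<open>Lp_int p f\<close> is finite.\<close>

lemma tendsto_Lp_int:
  fixes f :: "real \<Rightarrow> 'a::euclidean_space"
  assumes p: "0 < p" "p \<le> 1" and F: "\<And>i. F i \<in> borel_measurable lebesgue" and f: "f \<in> borel_measurable lebesgue"
    and fin: "Lp_int p f < \<infinity>" and lim: "(\<lambda>i. Lp_int p (\<lambda>x. F i x - f x)) \<longlonglongrightarrow> 0"
  shows "(\<lambda>i. Lp_int p (F i)) \<longlonglongrightarrow> Lp_int p f"
proof (rule tendsto_sandwich)
  let ?d = "\<lambda>i. Lp_int p (\<lambda>x. F i x - f x)"
  have "Lp_int p f \<le> Lp_int p (F i) + ?d i" for i
    using Lp_int_diff_le[of "F i" "\<lambda>x. F i x - f x" p] F[of i] f p by simp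
  then show "\<forall>\<^sub>F i in sequentially. Lp_int p f - ?d i \<le> Lp_int p (F i)"
    using fin by (intro always_eventually allI) (auto simp: ennreal_minus_le_iff add.commute)
  have "Lp_int p (F i) \<le> Lp_int p f + ?d i" for i
    using Lp_int_add_le[of f "\<lambda>x. F i x - f x" p] F[of i] f p by simp
  then show "\<forall>\<^sub>F i in sequentially. Lp_int p (F i) \<le> Lp_int p f + ?d i" by simp
  show "(\<lambda>i. Lp_int p f + ?d i) \<longlonglongrightarrow> Lp_int p f"
    using tendsto_add[OF tendsto_const lim] by simp
  show "(\<lambda>i. Lp_int p f - ?d i) \<longlonglongrightarrow> Lp_int p f"
    using tendsto_diff_ennreal[OF tendsto_const lim, of "Lp_int p f"] fin by simp
qed

lemma divide_ennreal_le_iff: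
  assumes "0 < m" "0 \<le> e"
  shows "x / ennreal m \<le> ennreal e \<longleftrightarrow> x \<le> ennreal (e * m)"
  using assms by (cases x) (auto simp: divide_ennreal ennreal_top_divide field_simps top_unique)

lemma divide_ennreal_le_self: "1 \<le> m \<Longrightarrow> x / ennreal m \<le> x"
  using mult_left_mono[of 1 m]
  by (cases x) (auto simp: divide_ennreal field_simps intro!: ennreal_leI)

text \<open>Separates order 0, which survives in the limit of a flat approximation, from the higher
  orders, which vanish.\<close>

lemma SUP_nat_split:
  fixes u :: "nat \<Rightarrow> 'a::complete_linorder"
  shows "(SUP k. u k) = max (u 0) (SUP k. u (Suc k))"
proof (rule antisym)
  have "u (Suc k) \<le> (SUP k. u (Suc k))" for k by (rule SUP_upper) simp
  then have "u k \<le> max (u 0) (SUP k. u (Suc k))" for k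
    by (cases k) (simp_all add: le_max_iff_disj)
  then show "(SUP k. u k) \<le> max (u 0) (SUP k. u (Suc k))" by (rule SUP_least)
  have u: "u k \<le> (SUP k. u k)" for k by (rule SUP_upper) simp
  show "max (u 0) (SUP k. u (Suc k)) \<le> (SUP k. u k)"
    by (rule max.boundedI[OF u SUP_least[OF u]])
qed

lemma quot_op1_eq:
  assumes "X \<noteq> {}" "\<And>u. u \<in> X \<Longrightarrow> R `` {h u} = Z"
  shows "quot_op1 R h X = Z"
  using assms by (auto simp: quot_op1_def)

lemma quot_op2_eq:
  assumes "X \<noteq> {}" "Y \<noteq> {}" "\<And>u v. u \<in> X \<Longrightarrow> v \<in> Y \<Longrightarrow> R `` {h u v} = Z"
  shows "quot_op2 R h X Y = Z"
  using assms by (auto simp: quot_op2_def)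

section \<open>The weighted quasi-norm and its Cauchy sequences\<close>

locale Carleman_weights =
  fixes p :: real and M :: "nat \<Rightarrow> real"
  assumes p_pos: "0 < p" and p_less_1: "p < 1" and M_ge_1: "\<And>k. 1 \<le> M k"
begin

lemma p_le_1: "p \<le> 1"
  using p_less_1 by simp

lemma M_pos: "0 < M k"
  using M_ge_1[of k] by linarith

text \<open>Replaces the supremum of quasi-norms by one bound on a p-integral for each order, where
  subadditivity has constant 1.\<close>

lemma C_norm_le_iff:
  assumes "0 \<le> e"
  shows "C_norm p M f \<le> ennreal e \<longleftrightarrow> (\<forall>k. Lp_int p (nth_deriv k f) \<le> ennreal ((e * M k) powr p))"
proof -
  have "0 \<le> e * M k" for k using assms M_pos[of k] by simp
  then show ?thesis
    using assms M_pos p_pos by (simp add: C_norm_def SUP_le_iff divide_ennreal_le_iff Lp_norm_le_iff)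
qed

text \<open>Each of the two p-integrals is at most the p-th power of \<open>(a + b) * M k\<close>;
  the resulting factor 2 becomes \<open>2 powr (1 / p)\<close> once it is moved under the
  power.\<close>

lemma C_norm_add_le:
  fixes f g :: "real \<Rightarrow> 'a::euclidean_space"
  assumes s: "smooth f" "smooth g" and e: "0 \<le> a" "0 \<le> b"
    and le: "C_norm p M f \<le> ennreal a" "C_norm p M g \<le> ennreal b"
  shows "C_norm p M (\<lambda>x. f x + g x) \<le> ennreal (2 powr (1 / p) * (a + b))"
proof -
  have "Lp_int p (\<lambda>x. nth_deriv k f x + nth_deriv k g x) \<le> ennreal ((2 powr (1 / p) * (a + b) * M k) powr p)" for k
  proof -
    have "Lp_int p (\<lambda>x. nth_deriv k f x + nth_deriv k g x) \<le> Lp_int p (nth_deriv k f) + Lp_int p (nth_deriv k g)"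
      using s p_pos p_le_1 by (intro Lp_int_add_le borel_measurable_nth_deriv)
    also have "\<dots> \<le> ennreal ((a * M k) powr p) + ennreal ((b * M k) powr p)"
      using le C_norm_le_iff e by (intro add_mono) auto
    also have "\<dots> = ennreal ((a * M k) powr p + (b * M k) powr p)" by simp
    also have "\<dots> \<le> ennreal (((a + b) * M k) powr p + ((a + b) * M k) powr p)"
      using e M_pos[of k] p_pos by (intro ennreal_leI add_mono powr_mono2 mult_right_mono) auto
    also have "((a + b) * M k) powr p + ((a + b) * M k) powr p = (2 powr (1 / p) * (a + b) * M k) powr p"
      using e M_pos[of k] p_pos by (simp add: powr_mult powr_powr)
    finally show ?thesis .
  qed
  then show ?thesis using e by (simp add: C_norm_le_iff nth_deriv_add[OF s])
qed

lemma C_norm_cmult_le: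
  fixes f :: "real \<Rightarrow> 'a::{real_normed_field, euclidean_space}"
  assumes s: "smooth f" and a: "0 \<le> a" "C_norm p M f \<le> ennreal a"
  shows "C_norm p M (\<lambda>x. c * f x) \<le> ennreal (norm c * a)"
proof -
  have "Lp_int p (\<lambda>x. c * nth_deriv k f x) \<le> ennreal ((norm c * a * M k) powr p)" for k
  proof -
    have "Lp_int p (\<lambda>x. c * nth_deriv k f x) = ennreal (norm c powr p) * Lp_int p (nth_deriv k f)"
      using s by (intro Lp_int_cmult borel_measurable_nth_deriv) (auto simp: norm_mult)
    also have "\<dots> \<le> ennreal (norm c powr p) * ennreal ((a * M k) powr p)"
      using a C_norm_le_iff by (intro mult_left_mono) auto
    also have "\<dots> = ennreal ((norm c * a * M k) powr p)"
      using a M_pos[of k] by (simp add: powr_mult mult.assoc flip: ennreal_mult)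
    finally show ?thesis .
  qed
  then show ?thesis
    using a by (simp add: C_norm_le_iff nth_deriv_linear[OF s bounded_linear_mult_right])
qed

lemma C_CauchyI:
  assumes "\<And>i. smooth (F i)" "\<And>i. C_norm p M (F i) < \<infinity>"
    "\<And>e. 0 < e \<Longrightarrow> \<exists>N. \<forall>i\<ge>N. \<forall>j\<ge>N. C_norm p M (\<lambda>x. F i x - F j x) \<le> ennreal e"
  shows "F \<in> C_Cauchy p M"
proof -
  have "\<exists>N. \<forall>i\<ge>N. \<forall>j\<ge>N. C_norm p M (\<lambda>x. F i x - F j x) < ennreal e" if e: "0 < e" for e
  proof -
    obtain N where N: "\<forall>i\<ge>N. \<forall>j\<ge>N. C_norm p M (\<lambda>x. F i x - F j x) \<le> ennreal (e / 2)"
      using assms(3)[of "e / 2"] e by auto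
    have "ennreal (e / 2) < ennreal e" using e by (simp add: ennreal_less_iff)
    then have "\<forall>i\<ge>N. \<forall>j\<ge>N. C_norm p M (\<lambda>x. F i x - F j x) < ennreal e"
      using N by (intro allI impI) (rule le_less_trans, simp_all)
    then show ?thesis by (rule exI)
  qed
  then show ?thesis using assms(1,2) by (simp add: C_Cauchy_def C_class_def)
qed

lemma C_CauchyD:
  assumes "F \<in> C_Cauchy p M"
  shows "smooth (F i)" "C_norm p M (F i) < \<infinity>"
    "0 < e \<Longrightarrow> \<exists>N. \<forall>i\<ge>N. \<forall>j\<ge>N. C_norm p M (\<lambda>x. F i x - F j x) \<le> ennreal e"
proof -
  show "smooth (F i)" "C_norm p M (F i) < \<infinity>" using assms by (simp_all add: C_Cauchy_def C_class_def)
  assume "0 < e"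
  moreover have "\<forall>e>0. \<exists>N. \<forall>i\<ge>N. \<forall>j\<ge>N. C_norm p M (\<lambda>x. F i x - F j x) < ennreal e"
    using assms by (simp add: C_Cauchy_def)
  ultimately obtain N where "\<forall>i\<ge>N. \<forall>j\<ge>N. C_norm p M (\<lambda>x. F i x - F j x) < ennreal e"
    by meson
  then show "\<exists>N. \<forall>i\<ge>N. \<forall>j\<ge>N. C_norm p M (\<lambda>x. F i x - F j x) \<le> ennreal e"
    by (intro exI[of _ N]) (simp add: less_imp_le)
qed

lemma C_Cauchy_measurable: "F \<in> C_Cauchy p M \<Longrightarrow> nth_deriv k (F i) \<in> borel_measurable lebesgue"
  by (rule borel_measurable_nth_deriv[OF C_CauchyD(1)])

lemma C_Cauchy_measurable_0: "F \<in> C_Cauchy p M \<Longrightarrow> F i \<in> borel_measurable lebesgue"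
  by (rule C_Cauchy_measurable[of F 0 i, unfolded nth_deriv_0])

lemma C_norm_finiteE:
  assumes "C_norm p M f < \<infinity>"
  obtains a where "0 \<le> a" "C_norm p M f \<le> ennreal a"
proof (cases "C_norm p M f")
  case (real r)
  then show ?thesis using that[of r] by simp
qed (use assms in simp)

lemma C_Cauchy_add:
  fixes F G :: "nat \<Rightarrow> real \<Rightarrow> 'a::euclidean_space"
  assumes F: "F \<in> C_Cauchy p M" and G: "G \<in> C_Cauchy p M"
  shows "(\<lambda>i x. F i x + G i x) \<in> C_Cauchy p M"
proof (rule C_CauchyI)
  have s: "smooth (F i)" "smooth (G i)" for i by (rule C_CauchyD(1)[OF F] C_CauchyD(1)[OF G])+
  show "smooth (\<lambda>x. F i x + G i x)" for i by (intro smooth_add s)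
  show "C_norm p M (\<lambda>x. F i x + G i x) < \<infinity>" for i
  proof -
    obtain a where a: "0 \<le> a" "C_norm p M (F i) \<le> ennreal a"
      by (rule C_norm_finiteE[OF C_CauchyD(2)[OF F]])
    obtain b where b: "0 \<le> b" "C_norm p M (G i) \<le> ennreal b"
      by (rule C_norm_finiteE[OF C_CauchyD(2)[OF G]])
    from a b have "C_norm p M (\<lambda>x. F i x + G i x) \<le> ennreal (2 powr (1 / p) * (a + b))"
      by (intro C_norm_add_le s)
    also have "\<dots> < \<infinity>" by simp
    finally show ?thesis .
  qed
  fix e :: real assume e: "0 < e"
  define d where "d = e / (2 * 2 powr (1 / p))"
  have d: "0 < d" "2 powr (1 / p) * (d + d) = e" using e by (auto simp: d_def)
  obtain N1 where N1: "\<forall>i\<ge>N1. \<forall>j\<ge>N1. C_norm p M (\<lambda>x. F i x - F j x) \<le> ennreal d"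
    using C_CauchyD(3)[OF F d(1)] by (rule exE)
  obtain N2 where N2: "\<forall>i\<ge>N2. \<forall>j\<ge>N2. C_norm p M (\<lambda>x. G i x - G j x) \<le> ennreal d"
    using C_CauchyD(3)[OF G d(1)] by (rule exE)
  have "C_norm p M (\<lambda>x. (F i x + G i x) - (F j x + G j x)) \<le> ennreal e"
    if "i \<ge> max N1 N2" "j \<ge> max N1 N2" for i j
  proof -
    have "C_norm p M (\<lambda>x. (F i x - F j x) + (G i x - G j x)) \<le> ennreal (2 powr (1 / p) * (d + d))"
      using N1 N2 that d(1) by (intro C_norm_add_le smooth_diff s) simp_all
    then show ?thesis unfolding d(2) by (simp add: algebra_simps)
  qed
  then show "\<exists>N. \<forall>i\<ge>N. \<forall>j\<ge>N. C_norm p M (\<lambda>x. (F i x + G i x) - (F j x + G j x)) \<le> ennreal e"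
    by blast
qed

lemma C_Cauchy_cmult:
  fixes F :: "nat \<Rightarrow> real \<Rightarrow> 'a::{real_normed_field, euclidean_space}"
  assumes F: "F \<in> C_Cauchy p M"
  shows "(\<lambda>i x. c * F i x) \<in> C_Cauchy p M"
proof (rule C_CauchyI)
  have s: "smooth (F i)" for i by (rule C_CauchyD(1)[OF F])
  show "smooth (\<lambda>x. c * F i x)" for i by (rule smooth_linear[OF s bounded_linear_mult_right])
  show "C_norm p M (\<lambda>x. c * F i x) < \<infinity>" for i
  proof -
    obtain a where "0 \<le> a" "C_norm p M (F i) \<le> ennreal a"
      by (rule C_norm_finiteE[OF C_CauchyD(2)[OF F]])
    then have "C_norm p M (\<lambda>x. c * F i x) \<le> ennreal (norm c * a)"
      by (intro C_norm_cmult_le s)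
    also have "\<dots> < \<infinity>" by simp
    finally show ?thesis .
  qed
  fix e :: real assume e: "0 < e"
  \<comment> \<open>The summand 1 covers \<open>c = 0\<close>.\<close>
  define d where "d = e / (norm c + 1)"
  have c1: "0 < norm c + 1" using norm_ge_zero[of c] by linarith
  have d: "0 < d" "norm c * d \<le> e" using e c1 by (auto simp: d_def field_simps)
  obtain N where N: "\<forall>i\<ge>N. \<forall>j\<ge>N. C_norm p M (\<lambda>x. F i x - F j x) \<le> ennreal d"
    using C_CauchyD(3)[OF F d(1)] by (rule exE)
  have "C_norm p M (\<lambda>x. c * F i x - c * F j x) \<le> ennreal e" if "i \<ge> N" "j \<ge> N" for i j
  proof -
    have "C_norm p M (\<lambda>x. c * (F i x - F j x)) \<le> ennreal (norm c * d)"
      using N that d(1) by (intro C_norm_cmult_le smooth_diff s) simp_all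
    also have "\<dots> \<le> ennreal e" using d(2) by (rule ennreal_leI)
    finally show ?thesis by (simp add: right_diff_distrib)
  qed
  then show "\<exists>N. \<forall>i\<ge>N. \<forall>j\<ge>N. C_norm p M (\<lambda>x. c * F i x - c * F j x) \<le> ennreal e" by blast
qed

section \<open>Flat approximations as full classes of the completion\<close>

lemma flat_approx_iff:
  "F \<in> flat_approx p M f \<longleftrightarrow> F \<in> C_Cauchy p M \<and> (\<lambda>i. Lp_int p (\<lambda>x. F i x - f x)) \<longlonglongrightarrow> 0 \<and>
     (\<forall>n\<ge>1. (\<lambda>i. Lp_int p (nth_deriv n (F i))) \<longlonglongrightarrow> 0)"
  by (simp add: flat_approx_def tendsto_Lp_norm_0_iff[OF p_pos])

lemma flat_approx_add:
  fixes f g :: "real \<Rightarrow> 'a::euclidean_space"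
  assumes F: "F \<in> flat_approx p M f" and G: "G \<in> flat_approx p M g"
    and fg: "f \<in> borel_measurable lebesgue" "g \<in> borel_measurable lebesgue"
  shows "(\<lambda>i x. F i x + G i x) \<in> flat_approx p M (\<lambda>x. f x + g x)"
  unfolding flat_approx_iff
proof (intro conjI allI impI)
  have C: "F \<in> C_Cauchy p M" "G \<in> C_Cauchy p M" using F G by (auto simp: flat_approx_iff)
  have s: "smooth (F i)" "smooth (G i)" for i using C by (auto intro: C_CauchyD(1))
  show "(\<lambda>i x. F i x + G i x) \<in> C_Cauchy p M" using C by (rule C_Cauchy_add)
  show "(\<lambda>i. Lp_int p (\<lambda>x. F i x + G i x - (f x + g x))) \<longlonglongrightarrow> 0"
  proof (rule tendsto_0_le_add_ennreal)
    show "(\<lambda>i. Lp_int p (\<lambda>x. F i x - f x)) \<longlonglongrightarrow> 0" "(\<lambda>i. Lp_int p (\<lambda>x. G i x - g x)) \<longlonglongrightarrow> 0"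
      using F G by (auto simp: flat_approx_iff)
    show "Lp_int p (\<lambda>x. F i x + G i x - (f x + g x))
        \<le> Lp_int p (\<lambda>x. F i x - f x) + Lp_int p (\<lambda>x. G i x - g x)" for i
      using Lp_int_add_le[of "\<lambda>x. F i x - f x" "\<lambda>x. G i x - g x" p] fg p_pos p_le_1
        C_Cauchy_measurable_0[OF C(1), of i] C_Cauchy_measurable_0[OF C(2), of i]
      by (simp add: add_diff_add)
  qed
  fix n :: nat assume "n \<ge> 1"
  then have l: "(\<lambda>i. Lp_int p (nth_deriv n (F i))) \<longlonglongrightarrow> 0" "(\<lambda>i. Lp_int p (nth_deriv n (G i))) \<longlonglongrightarrow> 0"
    using F G by (auto simp: flat_approx_iff)
  show "(\<lambda>i. Lp_int p (nth_deriv n (\<lambda>x. F i x + G i x))) \<longlonglongrightarrow> 0"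
    unfolding nth_deriv_add[OF s]
    by (rule tendsto_0_le_add_ennreal[OF l]) (intro Lp_int_add_le C_Cauchy_measurable C p_pos p_le_1)
qed

lemma flat_approx_cmult:
  fixes f :: "real \<Rightarrow> 'a::{real_normed_field, euclidean_space}"
  assumes F: "F \<in> flat_approx p M f" and f: "f \<in> borel_measurable lebesgue"
  shows "(\<lambda>i x. c * F i x) \<in> flat_approx p M (\<lambda>x. c * f x)"
  unfolding flat_approx_iff
proof (intro conjI allI impI)
  have C: "F \<in> C_Cauchy p M" using F by (auto simp: flat_approx_iff)
  have s: "smooth (F i)" for i using C by (auto intro: C_CauchyD(1))
  have eq: "Lp_int p (\<lambda>x. c * g x) = ennreal (norm c powr p) * Lp_int p g"
    if "g \<in> borel_measurable lebesgue" for g :: "real \<Rightarrow> 'a"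
    using that by (intro Lp_int_cmult) (auto simp: norm_mult)
  have lim: "(\<lambda>i. ennreal (norm c powr p) * X i) \<longlonglongrightarrow> 0" if "X \<longlonglongrightarrow> 0" for X
    using ennreal_tendsto_cmult[OF _ that, of "ennreal (norm c powr p)"] by simp
  show "(\<lambda>i x. c * F i x) \<in> C_Cauchy p M" using C by (rule C_Cauchy_cmult)
  have "(\<lambda>i. Lp_int p (\<lambda>x. c * (F i x - f x))) \<longlonglongrightarrow> 0"
    using F C_Cauchy_measurable_0[OF C] f by (subst eq) (auto simp: flat_approx_iff intro: lim)
  then show "(\<lambda>i. Lp_int p (\<lambda>x. c * F i x - c * f x)) \<longlonglongrightarrow> 0"
    by (simp add: right_diff_distrib)
  fix n :: nat assume "n \<ge> 1"
  then show "(\<lambda>i. Lp_int p (nth_deriv n (\<lambda>x. c * F i x))) \<longlonglongrightarrow> 0"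
    using F unfolding nth_deriv_linear[OF s bounded_linear_mult_right] eq[OF C_Cauchy_measurable[OF C]]
    by (auto simp: flat_approx_iff intro: lim)
qed

lemma flat_approx_diff:
  fixes f g :: "real \<Rightarrow> 'a::{real_normed_field, euclidean_space}"
  assumes F: "F \<in> flat_approx p M f" and G: "G \<in> flat_approx p M g"
    and fg: "f \<in> borel_measurable lebesgue" "g \<in> borel_measurable lebesgue"
  shows "(\<lambda>i x. F i x - G i x) \<in> flat_approx p M (\<lambda>x. f x - g x)"
  using flat_approx_add[OF F flat_approx_cmult[OF G fg(2), of "-1"]] fg by simp

text \<open>Flatness gives convergence for each order separately; the Cauchy condition makes it
  uniform. For a fixed order \<open>F i\<close> is compared with \<open>F j\<close>, the difference
  being bounded uniformly over all orders, and then \<open>j\<close> tends to infinity.\<close>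

lemma flat_approx_derivs:
  fixes f :: "real \<Rightarrow> 'a::euclidean_space"
  assumes F: "F \<in> flat_approx p M f"
  shows "(\<lambda>i. SUP k. Lp_norm p (nth_deriv (Suc k) (F i)) / ennreal (M (Suc k))) \<longlonglongrightarrow> 0"
  unfolding tendsto_0_ennreal_iff
proof (intro allI impI)
  have C: "F \<in> C_Cauchy p M" using F by (auto simp: flat_approx_iff)
  have s: "smooth (F i)" for i using C by (auto intro: C_CauchyD(1))
  fix e :: real assume e: "0 < e"
  obtain N where N: "\<forall>i\<ge>N. \<forall>j\<ge>N. C_norm p M (\<lambda>x. F i x - F j x) \<le> ennreal e"
    using C_CauchyD(3)[OF C e] by (rule exE)
  have "Lp_int p (nth_deriv (Suc k) (F i)) \<le> ennreal ((e * M (Suc k)) powr p)" if "i \<ge> N" for i k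
  proof -
    let ?n = "Suc k"
    have le: "Lp_int p (nth_deriv ?n (F i)) \<le> ennreal ((e * M ?n) powr p) + Lp_int p (nth_deriv ?n (F j))"
      if "j \<ge> N" for j
    proof -
      have "Lp_int p (nth_deriv ?n (F i)) \<le> Lp_int p (\<lambda>x. nth_deriv ?n (F i) x - nth_deriv ?n (F j) x) + Lp_int p (nth_deriv ?n (F j))"
        using Lp_int_add_le[of "\<lambda>x. nth_deriv ?n (F i) x - nth_deriv ?n (F j) x" "nth_deriv ?n (F j)" p]
          C_Cauchy_measurable[OF C, of ?n i] C_Cauchy_measurable[OF C, of ?n j] p_pos p_le_1 by simp
      moreover have "Lp_int p (\<lambda>x. nth_deriv ?n (F i) x - nth_deriv ?n (F j) x) \<le> ennreal ((e * M ?n) powr p)"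
        using N that \<open>i \<ge> N\<close> e by (simp add: C_norm_le_iff flip: nth_deriv_diff[OF s s])
      ultimately show ?thesis by (meson add_right_mono order_trans)
    qed
    have "(\<lambda>j. ennreal ((e * M ?n) powr p) + Lp_int p (nth_deriv ?n (F j))) \<longlonglongrightarrow> ennreal ((e * M ?n) powr p) + 0"
      using F by (intro tendsto_add tendsto_const) (auto simp: flat_approx_iff)
    then show ?thesis using le by (intro LIMSEQ_le_const) auto
  qed
  moreover have "0 \<le> e * M k" for k using e M_pos[of k] by simp
  ultimately show "\<forall>\<^sub>F i in sequentially. (SUP k. Lp_norm p (nth_deriv (Suc k) (F i)) / ennreal (M (Suc k))) \<le> ennreal e"
    using e M_pos p_pos unfolding eventually_sequentially
    by (intro exI[of _ N]) (auto simp: SUP_le_iff divide_ennreal_le_iff Lp_norm_le_iff)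
qed

text \<open>The supremum is the maximum of the term of order 0, which converges to the claimed
  limit, and a remainder that tends to 0 by \<open>flat_approx_derivs\<close>.\<close>

lemma tendsto_C_norm_flat_approx:
  fixes f :: "real \<Rightarrow> 'a::euclidean_space"
  assumes F: "F \<in> flat_approx p M f" and f: "f \<in> Lp_fun p"
  shows "(\<lambda>i. C_norm p M (F i)) \<longlonglongrightarrow> Lp_norm p f / ennreal (M 0)"
proof -
  have C: "F \<in> C_Cauchy p M" using F by (auto simp: flat_approx_iff)
  have "(\<lambda>i. Lp_norm p (F i)) \<longlonglongrightarrow> Lp_norm p f"
    using F f C_Cauchy_measurable_0[OF C] p_pos p_le_1
    by (intro tendsto_Lp_norm tendsto_Lp_int) (auto simp: flat_approx_iff Lp_fun_iff)
  then have "(\<lambda>i. Lp_norm p (F i) / ennreal (M 0)) \<longlonglongrightarrow> Lp_norm p f / ennreal (M 0)"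
    unfolding divide_ennreal_def mult.commute[of _ "inverse _"]
    using M_pos[of 0] by (intro ennreal_tendsto_cmult) (simp_all add: inverse_ennreal)
  from tendsto_max[OF this flat_approx_derivs[OF F]] show ?thesis
    unfolding C_norm_def by (subst SUP_nat_split) (simp add: max_absorb1)
qed

lemma zero_in_Lp_fun: "(\<lambda>x. 0) \<in> Lp_fun p"
  by (simp add: Lp_fun_iff)

text \<open>Two flat approximations of \<open>f\<close> differ by one of the zero function, whose
  quasi-norms tend to 0. Conversely a null sequence for \<open>C_norm\<close> is small in every
  single order, so adding it preserves both the limit and the flatness.\<close>

lemma C_rel_flat_approx:
  fixes f :: "real \<Rightarrow> 'a::{real_normed_field, euclidean_space}"
  assumes F: "F \<in> flat_approx p M f" and f: "f \<in> borel_measurable lebesgue"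
  shows "C_rel p M `` {F} = flat_approx p M f"
proof (intro set_eqI iffI)
  have C: "F \<in> C_Cauchy p M" using F by (auto simp: flat_approx_iff)
  fix G
  {
    assume G: "G \<in> flat_approx p M f"
    have "(\<lambda>i. C_norm p M (\<lambda>x. F i x - G i x)) \<longlonglongrightarrow> Lp_norm p (\<lambda>x. 0 :: 'a) / ennreal (M 0)"
      using flat_approx_diff[OF F G f f] by (intro tendsto_C_norm_flat_approx zero_in_Lp_fun) simp
    then show "G \<in> C_rel p M `` {F}"
      using F G by (simp add: C_rel_def flat_approx_iff Lp_norm_eq)
  next
    assume "G \<in> C_rel p M `` {F}"
    then have G: "G \<in> C_Cauchy p M" and lim: "(\<lambda>i. C_norm p M (\<lambda>x. F i x - G i x)) \<longlonglongrightarrow> 0"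
      by (auto simp: C_rel_def)
    have s: "smooth (F i)" "smooth (G i)" for i by (rule C_CauchyD(1)[OF C] C_CauchyD(1)[OF G])+
    have d: "(\<lambda>i. Lp_int p (\<lambda>x. nth_deriv k (F i) x - nth_deriv k (G i) x)) \<longlonglongrightarrow> 0" for k
      unfolding tendsto_0_ennreal_iff
    proof (intro allI impI)
      fix e :: real assume e: "0 < e"
      \<comment> \<open>Chosen so that the bound of \<open>C_norm_le_iff\<close> at order
        \<open>k\<close> is exactly \<open>e\<close>.\<close>
      define a where "a = e powr (1 / p) / M k"
      have a: "0 < a" "(a * M k) powr p = e" using e M_pos[of k] p_pos by (auto simp: a_def powr_powr)
      have "\<forall>\<^sub>F i in sequentially. C_norm p M (\<lambda>x. F i x - G i x) \<le> ennreal a"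
        using lim a(1) unfolding tendsto_0_ennreal_iff by simp
      then show "\<forall>\<^sub>F i in sequentially. Lp_int p (\<lambda>x. nth_deriv k (F i) x - nth_deriv k (G i) x) \<le> ennreal e"
      proof eventually_elim
        case (elim i)
        then have "Lp_int p (nth_deriv k (\<lambda>x. F i x - G i x)) \<le> ennreal ((a * M k) powr p)"
          using a(1) C_norm_le_iff[of a] by auto
        then show ?case by (simp add: a(2) nth_deriv_diff[OF s])
      qed
    qed
    show "G \<in> flat_approx p M f"
      unfolding flat_approx_iff
    proof (intro conjI allI impI G)
      show "(\<lambda>i. Lp_int p (\<lambda>x. G i x - f x)) \<longlonglongrightarrow> 0"
      proof (rule tendsto_0_le_add_ennreal)
        show "(\<lambda>i. Lp_int p (\<lambda>x. G i x - F i x)) \<longlonglongrightarrow> 0"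
          using d[of 0] by (subst Lp_int_diff_commute) simp
        show "(\<lambda>i. Lp_int p (\<lambda>x. F i x - f x)) \<longlonglongrightarrow> 0" using F by (simp add: flat_approx_iff)
      qed (intro Lp_int_triangle C_Cauchy_measurable_0 C G f p_pos p_le_1)
      fix n :: nat assume "n \<ge> 1"
      then have l: "(\<lambda>i. Lp_int p (nth_deriv n (F i))) \<longlonglongrightarrow> 0" using F by (simp add: flat_approx_iff)
      show "(\<lambda>i. Lp_int p (nth_deriv n (G i))) \<longlonglongrightarrow> 0"
      proof (rule tendsto_0_le_add_ennreal[OF l d])
        show "Lp_int p (nth_deriv n (G i)) \<le> Lp_int p (nth_deriv n (F i)) +
            Lp_int p (\<lambda>x. nth_deriv n (F i) x - nth_deriv n (G i) x)" for i
          using Lp_int_diff_le[of "nth_deriv n (F i)" "\<lambda>x. nth_deriv n (F i) x - nth_deriv n (G i) x" p]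
            C_Cauchy_measurable[OF C, of n i] C_Cauchy_measurable[OF G, of n i] p_pos p_le_1 by simp
      qed
    qed
  }
qed

text \<open>Approximations with errors \<open>r i\<close> tending to 0 work: their bounds are
  uniform in the order, and weights \<open>M k \<ge> 1\<close> only relax what \<open>C_norm\<close>
  requires.\<close>

lemma flat_approx_nonempty:
  fixes f :: "real \<Rightarrow> 'a::euclidean_space"
  assumes f: "f \<in> Lp_fun p"
  shows "flat_approx p M f \<noteq> {}"
proof -
  have fm: "f \<in> borel_measurable lebesgue" and fin: "Lp_int p f < \<infinity>" using f by (auto simp: Lp_fun_iff)
  have fl: "flat_limit p f" using p_pos p_less_1 fm fin by (rule flat_limit_Lp)
  define r where "r i = inverse (real (Suc i))" for i
  have r: "0 < r i" for i by (simp add: r_def)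
  have r0: "(\<lambda>i. ennreal (r i)) \<longlonglongrightarrow> 0"
    using tendsto_ennrealI[OF LIMSEQ_inverse_real_of_nat] by (simp add: r_def)
  have "\<forall>i. \<exists>\<phi>. smooth \<phi> \<and> Lp_int p (\<lambda>x. \<phi> x - f x) \<le> ennreal (r i) \<and>
        (\<forall>k\<ge>1. Lp_int p (nth_deriv k \<phi>) \<le> ennreal (r i))"
    using fl r unfolding flat_limit_def by blast
  then obtain F where F: "\<And>i. smooth (F i)" "\<And>i. Lp_int p (\<lambda>x. F i x - f x) \<le> ennreal (r i)"
    "\<And>i k. k \<ge> 1 \<Longrightarrow> Lp_int p (nth_deriv k (F i)) \<le> ennreal (r i)"
    by metis
  have m: "nth_deriv k (F i) \<in> borel_measurable lebesgue" for k i
    using F(1) by (rule borel_measurable_nth_deriv)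
  have m0: "F i \<in> borel_measurable lebesgue" for i using m[of 0] by simp
  have C: "F \<in> C_Cauchy p M"
  proof (rule C_CauchyI[OF F(1)])
    fix i
    have "Lp_int p (F i) \<le> Lp_int p (\<lambda>x. F i x - f x) + Lp_int p f"
      using Lp_int_add_le[of "\<lambda>x. F i x - f x" f p] m0[of i] fm p_pos p_le_1 by simp
    also have "\<dots> < \<infinity>" using F(2)[of i] fin by (auto simp: less_top[symmetric] top_unique)
    finally obtain b where b: "0 \<le> b" "Lp_int p (F i) = ennreal b" by (cases "Lp_int p (F i)") auto
    \<comment> \<open>Its p-th power \<open>b + r i\<close> dominates order 0, which contributes
      \<open>b\<close>, and all higher orders, which contribute at most \<open>r i\<close>.\<close>
    define a where "a = (b + r i) powr (1 / p)"
    have "Lp_int p (nth_deriv k (F i)) \<le> ennreal ((a * M k) powr p)" for k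
    proof -
      have "Lp_int p (nth_deriv k (F i)) \<le> ennreal (b + r i)"
      proof (cases k)
        case 0
        then show ?thesis using b r[of i] by (auto intro!: ennreal_leI)
      next
        case (Suc k')
        then have "Lp_int p (nth_deriv k (F i)) \<le> ennreal (r i)" by (intro F(3)) simp
        also have "\<dots> \<le> ennreal (b + r i)" using b by (intro ennreal_leI) simp
        finally show ?thesis .
      qed
      also have "b + r i = (a * 1) powr p" using b r[of i] p_pos by (simp add: a_def powr_powr)
      also have "ennreal \<dots> \<le> ennreal ((a * M k) powr p)"
        using M_ge_1[of k] p_pos by (intro ennreal_leI powr_mono2 mult_left_mono) (auto simp: a_def)
      finally show ?thesis .
    qed
    then have "C_norm p M (F i) \<le> ennreal a"
      by (subst C_norm_le_iff) (auto simp: a_def)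
    also have "\<dots> < \<infinity>" by simp
    finally show "C_norm p M (F i) < \<infinity>" .
  next
    fix e :: real assume e: "0 < e"
    have "e powr p / 2 > 0" using e by simp
    then obtain N where N: "r N < e powr p / 2" unfolding r_def using reals_Archimedean by blast
    have "C_norm p M (\<lambda>x. F i x - F j x) \<le> ennreal e" if "i \<ge> N" "j \<ge> N" for i j
    proof -
      have rr: "ennreal (r i) + ennreal (r j) \<le> ennreal (e powr p)"
      proof -
        have "r i \<le> r N" "r j \<le> r N" using that by (auto simp: r_def intro!: le_imp_inverse_le)
        then show ?thesis using N r[of i] r[of j] by (auto simp flip: ennreal_plus intro!: ennreal_leI)
      qed
      have "Lp_int p (\<lambda>x. nth_deriv k (F i) x - nth_deriv k (F j) x) \<le> ennreal ((e * M k) powr p)" for k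
      proof -
        \<comment> \<open>At order 0 the functions need not be small, so they are compared through
          \<open>f\<close>; at higher orders the two terms are small separately.\<close>
        have "Lp_int p (\<lambda>x. nth_deriv k (F i) x - nth_deriv k (F j) x) \<le> ennreal (r i) + ennreal (r j)"
        proof (cases "k = 0")
          case True
          have "Lp_int p (\<lambda>x. F i x - F j x) \<le> Lp_int p (\<lambda>x. F i x - f x) + Lp_int p (\<lambda>x. f x - F j x)"
            by (intro Lp_int_triangle m0 fm p_pos p_le_1)
          also have "\<dots> \<le> ennreal (r i) + ennreal (r j)"
            using F(2)[of i] F(2)[of j] by (intro add_mono) (auto simp: Lp_int_diff_commute[of p f])
          finally show ?thesis using True by simp
        next
          case False
          have "Lp_int p (\<lambda>x. nth_deriv k (F i) x - nth_deriv k (F j) x)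
              \<le> Lp_int p (nth_deriv k (F i)) + Lp_int p (nth_deriv k (F j))"
            by (intro Lp_int_diff_le m p_pos p_le_1)
          also have "\<dots> \<le> ennreal (r i) + ennreal (r j)" using False by (intro add_mono F(3)) auto
          finally show ?thesis .
        qed
        also note rr
        also have "ennreal (e powr p) \<le> ennreal ((e * M k) powr p)"
          using M_ge_1[of k] p_pos e by (intro ennreal_leI powr_mono2) auto
        finally show ?thesis .
      qed
      then show ?thesis using e by (simp add: C_norm_le_iff nth_deriv_diff[OF F(1) F(1)])
    qed
    then show "\<exists>N. \<forall>i\<ge>N. \<forall>j\<ge>N. C_norm p M (\<lambda>x. F i x - F j x) \<le> ennreal e" by blast
  qed
  have "F \<in> flat_approx p M f"
    unfolding flat_approx_iff using F(2,3)
    by (intro conjI allI impI C) (auto intro!: tendsto_0_le_add_ennreal[OF r0 tendsto_const])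
  then show ?thesis by blast
qed

lemma flat_approx_cong:
  assumes "AE x in lebesgue. f x = g x"
  shows "flat_approx p M f = flat_approx p M g"
proof -
  have "Lp_int p (\<lambda>x. h x - f x) = Lp_int p (\<lambda>x. h x - g x)" for h
    unfolding Lp_int_def using assms by (intro nn_integral_cong_AE) auto
  then show ?thesis by (auto simp: flat_approx_iff)
qed

text \<open>This is injectivity: a common flat approximation converges to both functions, so the
  p-integral of \<open>f - g\<close>, as a constant sequence tending to 0, vanishes.\<close>

lemma flat_approx_eqD:
  fixes f g :: "real \<Rightarrow> 'a::euclidean_space"
  assumes f: "f \<in> Lp_fun p" and g: "g \<in> Lp_fun p" and eq: "flat_approx p M f = flat_approx p M g"
  shows "AE x in lebesgue. f x = g x"
proof -
  obtain F where F: "F \<in> flat_approx p M f" "F \<in> flat_approx p M g"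
    using flat_approx_nonempty[OF f] eq by blast
  have C: "F \<in> C_Cauchy p M" using F by (auto simp: flat_approx_iff)
  have [measurable]: "f \<in> borel_measurable lebesgue" "g \<in> borel_measurable lebesgue"
    using f g by (auto simp: Lp_fun_iff)
  have "(\<lambda>i::nat. Lp_int p (\<lambda>x. f x - g x)) \<longlonglongrightarrow> 0"
  proof (rule tendsto_0_le_add_ennreal)
    show "(\<lambda>i. Lp_int p (\<lambda>x. f x - F i x)) \<longlonglongrightarrow> 0" "(\<lambda>i. Lp_int p (\<lambda>x. F i x - g x)) \<longlonglongrightarrow> 0"
      using F by (auto simp: flat_approx_iff Lp_int_diff_commute[of p f])
  qed (intro Lp_int_triangle C_Cauchy_measurable_0 C Lp_fun_measurable[OF f] Lp_fun_measurable[OF g] p_pos p_le_1)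
  then have "Lp_int p (\<lambda>x. f x - g x) = 0" by (simp add: LIMSEQ_const_iff)
  then have "AE x in lebesgue. ennreal (norm (f x - g x) powr p) = 0"
    unfolding Lp_int_def by (subst (asm) nn_integral_0_iff_AE) auto
  then show ?thesis by eventually_elim (simp add: ennreal_eq_0_iff)
qed

section \<open>Operations and quasi-norms on classes\<close>

lemma Lp_fun_add:
  fixes f g :: "real \<Rightarrow> 'a::euclidean_space"
  assumes "f \<in> Lp_fun p" "g \<in> Lp_fun p"
  shows "(\<lambda>x. f x + g x) \<in> Lp_fun p"
  using assms Lp_int_add_le[of f g p] p_pos p_le_1
  by (auto simp: Lp_fun_iff less_top[symmetric] top_unique)

lemma Lp_fun_cmult:
  fixes f :: "real \<Rightarrow> 'a::{real_normed_field, euclidean_space}"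
  assumes "f \<in> Lp_fun p"
  shows "(\<lambda>x. c * f x) \<in> Lp_fun p"
  using assms Lp_int_cmult[of f "norm c" "\<lambda>x. c * f x" p]
  by (auto simp: Lp_fun_iff norm_mult ennreal_mult_less_top)

lemma Lp_fun_diff:
  fixes f g :: "real \<Rightarrow> 'a::{real_normed_field, euclidean_space}"
  assumes "f \<in> Lp_fun p" "g \<in> Lp_fun p"
  shows "(\<lambda>x. f x - g x) \<in> Lp_fun p"
  using Lp_fun_add[OF assms(1) Lp_fun_cmult[OF assms(2), of "-1"]] by simp

lemma Lp_rel_iff: "(f, g) \<in> Lp_rel p \<longleftrightarrow> f \<in> Lp_fun p \<and> g \<in> Lp_fun p \<and> (AE x in lebesgue. f x = g x)"
  by (auto simp: Lp_rel_def)

lemma Lp_rel_Image_eq: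
  assumes "f \<in> Lp_fun p" "g \<in> Lp_fun p" "AE x in lebesgue. f x = g x"
  shows "Lp_rel p `` {f} = Lp_rel p `` {g}"
proof -
  have "(AE x in lebesgue. f x = h x) \<longleftrightarrow> (AE x in lebesgue. g x = h x)" for h
    using assms(3) by (auto elim: eventually_elim2)
  then show ?thesis using assms(1,2) by (auto simp: Lp_rel_iff)
qed

lemma Lp_add_class:
  fixes f g :: "real \<Rightarrow> 'a::euclidean_space"
  assumes fg: "f \<in> Lp_fun p" "g \<in> Lp_fun p"
  shows "Lp_add p (Lp_rel p `` {f}) (Lp_rel p `` {g}) = Lp_rel p `` {\<lambda>x. f x + g x}"
  unfolding Lp_add_def
proof (rule quot_op2_eq)
  have "f \<in> Lp_rel p `` {f}" "g \<in> Lp_rel p `` {g}" using fg by (auto simp: Lp_rel_iff)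
  then show "Lp_rel p `` {f} \<noteq> {}" "Lp_rel p `` {g} \<noteq> {}" by auto
  fix u v assume "u \<in> Lp_rel p `` {f}" "v \<in> Lp_rel p `` {g}"
  then have uv: "u \<in> Lp_fun p" "v \<in> Lp_fun p" "AE x in lebesgue. f x = u x" "AE x in lebesgue. g x = v x"
    by (auto simp: Lp_rel_iff)
  show "Lp_rel p `` {\<lambda>x. u x + v x} = Lp_rel p `` {\<lambda>x. f x + g x}"
    using uv by (intro Lp_rel_Image_eq Lp_fun_add fg) (auto elim: eventually_elim2)
qed

lemma Lp_diff_class:
  fixes f g :: "real \<Rightarrow> 'a::{real_normed_field, euclidean_space}"
  assumes fg: "f \<in> Lp_fun p" "g \<in> Lp_fun p"
  shows "Lp_diff p (Lp_rel p `` {f}) (Lp_rel p `` {g}) = Lp_rel p `` {\<lambda>x. f x - g x}"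
  unfolding Lp_diff_def
proof (rule quot_op2_eq)
  have "f \<in> Lp_rel p `` {f}" "g \<in> Lp_rel p `` {g}" using fg by (auto simp: Lp_rel_iff)
  then show "Lp_rel p `` {f} \<noteq> {}" "Lp_rel p `` {g} \<noteq> {}" by auto
  fix u v assume "u \<in> Lp_rel p `` {f}" "v \<in> Lp_rel p `` {g}"
  then have uv: "u \<in> Lp_fun p" "v \<in> Lp_fun p" "AE x in lebesgue. f x = u x" "AE x in lebesgue. g x = v x"
    by (auto simp: Lp_rel_iff)
  show "Lp_rel p `` {\<lambda>x. u x - v x} = Lp_rel p `` {\<lambda>x. f x - g x}"
    using uv by (intro Lp_rel_Image_eq Lp_fun_diff fg) (auto elim: eventually_elim2)
qed

lemma Lp_scale_class:
  fixes f :: "real \<Rightarrow> 'a::{real_normed_field, euclidean_space}"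
  assumes f: "f \<in> Lp_fun p"
  shows "Lp_scale p c (Lp_rel p `` {f}) = Lp_rel p `` {\<lambda>x. c * f x}"
  unfolding Lp_scale_def
proof (rule quot_op1_eq)
  have "f \<in> Lp_rel p `` {f}" using f by (auto simp: Lp_rel_iff)
  then show "Lp_rel p `` {f} \<noteq> {}" by auto
  fix u assume "u \<in> Lp_rel p `` {f}"
  then have u: "u \<in> Lp_fun p" "AE x in lebesgue. f x = u x"
    by (auto simp: Lp_rel_iff)
  from u(2) have "AE x in lebesgue. c * u x = c * f x" by eventually_elim simp
  then show "Lp_rel p `` {\<lambda>x. c * u x} = Lp_rel p `` {\<lambda>x. c * f x}"
    using u(1) by (intro Lp_rel_Image_eq Lp_fun_cmult f)
qed

lemma Lp_qnorm_class:
  assumes f: "f \<in> Lp_fun p"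
  shows "Lp_qnorm p (Lp_rel p `` {f}) = Lp_norm p f"
proof -
  have "Lp_norm p g = Lp_norm p f" if "g \<in> Lp_rel p `` {f}" for g
  proof -
    have "Lp_int p g = Lp_int p f"
      unfolding Lp_int_def using that by (intro nn_integral_cong_AE) (auto simp: Lp_rel_iff)
    then show ?thesis by (simp add: Lp_norm_eq)
  qed
  moreover have "f \<in> Lp_rel p `` {f}" using f by (auto simp: Lp_rel_iff)
  ultimately have "Lp_norm p ` (Lp_rel p `` {f}) = {Lp_norm p f}" by blast
  then show ?thesis by (simp add: Lp_qnorm_def)
qed

lemma compl_add_flat_approx:
  fixes f g :: "real \<Rightarrow> 'a::{real_normed_field, euclidean_space}"
  assumes "f \<in> Lp_fun p" "g \<in> Lp_fun p"
  shows "compl_add p M (flat_approx p M f) (flat_approx p M g) = flat_approx p M (\<lambda>x. f x + g x)"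
  unfolding compl_add_def using assms
  by (intro quot_op2_eq flat_approx_nonempty C_rel_flat_approx flat_approx_add)
     (auto simp: Lp_fun_iff)

lemma compl_diff_flat_approx:
  fixes f g :: "real \<Rightarrow> 'a::{real_normed_field, euclidean_space}"
  assumes "f \<in> Lp_fun p" "g \<in> Lp_fun p"
  shows "compl_diff p M (flat_approx p M f) (flat_approx p M g) = flat_approx p M (\<lambda>x. f x - g x)"
  unfolding compl_diff_def using assms
  by (intro quot_op2_eq flat_approx_nonempty C_rel_flat_approx flat_approx_diff)
     (auto simp: Lp_fun_iff)

lemma compl_scale_flat_approx:
  fixes f :: "real \<Rightarrow> 'a::{real_normed_field, euclidean_space}"
  assumes "f \<in> Lp_fun p"
  shows "compl_scale p M c (flat_approx p M f) = flat_approx p M (\<lambda>x. c * f x)"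
  unfolding compl_scale_def using assms
  by (intro quot_op1_eq flat_approx_nonempty C_rel_flat_approx flat_approx_cmult)
     (auto simp: Lp_fun_iff)

text \<open>All members of the class are flat approximations of \<open>f\<close> and share one
  limit, so \<open>the_elem\<close> is applied to a singleton.\<close>

lemma compl_qnorm_flat_approx:
  fixes f :: "real \<Rightarrow> 'a::euclidean_space"
  assumes f: "f \<in> Lp_fun p"
  shows "compl_qnorm p M (flat_approx p M f) = Lp_norm p f / ennreal (M 0)"
proof -
  have "lim (\<lambda>i. C_norm p M (F i)) = Lp_norm p f / ennreal (M 0)" if "F \<in> flat_approx p M f" for F
    using tendsto_C_norm_flat_approx[OF that f] by (rule limI)
  then have "(\<lambda>F. lim (\<lambda>i. C_norm p M (F i))) ` flat_approx p M f = {Lp_norm p f / ennreal (M 0)}"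
    using flat_approx_nonempty[OF f] by auto
  then show ?thesis by (simp add: compl_qnorm_def)
qed

end

theorem theorem3p6:
  fixes p :: real and M :: "nat \<Rightarrow> real"
  assumes "0 < p" and "p < 1" and "\<And>k. M k \<ge> 1"
  shows "\<exists>T :: (real \<Rightarrow> 'a::{real_normed_field, euclidean_space}) set \<Rightarrow> (nat \<Rightarrow> real \<Rightarrow> 'a) set.
    T ` Lp_space p \<subseteq> C_completion p M \<and>
    inj_on T (Lp_space p) \<and>
    linear_Lp_compl p M T \<and>
    continuous_Lp_compl p M T \<and>
    (\<forall>f\<in>Lp_fun p.
       flat_approx p M f \<noteq> {} \<and>
       (\<forall>F\<in>flat_approx p M f. T (Lp_rel p `` {f}) = C_rel p M `` {F}))"
proof -
  interpret Carleman_weights p M using assms by unfold_locales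
  \<comment> \<open>The union over representatives avoids a choice: all the sets united coincide by
    \<open>flat_approx_cong\<close>.\<close>
  define T :: "(real \<Rightarrow> 'a) set \<Rightarrow> (nat \<Rightarrow> real \<Rightarrow> 'a) set"
    where "T X = (\<Union>f\<in>X. flat_approx p M f)" for X
  have T: "T (Lp_rel p `` {f}) = flat_approx p M f" if "f \<in> Lp_fun p" for f
  proof -
    have "f \<in> Lp_rel p `` {f}" using that by (auto simp: Lp_rel_iff)
    moreover have "flat_approx p M g = flat_approx p M f" if "g \<in> Lp_rel p `` {f}" for g
      using that flat_approx_cong[of f g] by (simp add: Lp_rel_iff)
    ultimately show ?thesis unfolding T_def by blast
  qed
  have cls: "\<exists>f\<in>Lp_fun p. X = Lp_rel p `` {f}" if "X \<in> Lp_space p" for X :: "(real \<Rightarrow> 'a) set"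
    using that unfolding Lp_space_def by (auto elim: quotientE)
  show ?thesis
  proof (intro exI[of _ T] conjI ballI)
    show "T ` Lp_space p \<subseteq> C_completion p M"
    proof
      fix Y assume "Y \<in> T ` Lp_space p"
      then obtain f where f: "f \<in> Lp_fun p" "Y = flat_approx p M f" using cls T by blast
      then obtain F where F: "F \<in> flat_approx p M f" using flat_approx_nonempty by blast
      then have "F \<in> C_Cauchy p M" by (simp add: flat_approx_iff)
      then show "Y \<in> C_completion p M"
        unfolding f(2) C_rel_flat_approx[OF F Lp_fun_measurable[OF f(1)], symmetric] C_completion_def
        by (rule quotientI)
    qed
    show "inj_on T (Lp_space p)"
    proof (rule inj_onI)
      fix X Y :: "(real \<Rightarrow> 'a) set" assume "X \<in> Lp_space p" "Y \<in> Lp_space p" and eq: "T X = T Y"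
      then obtain f g where fg: "f \<in> Lp_fun p" "g \<in> Lp_fun p" "X = Lp_rel p `` {f}" "Y = Lp_rel p `` {g}"
        using cls by blast
      then have "flat_approx p M f = flat_approx p M g" using eq T by simp
      then show "X = Y" unfolding fg(3,4) using fg(1,2) by (intro Lp_rel_Image_eq flat_approx_eqD)
    qed
    show "linear_Lp_compl p M T"
      unfolding linear_Lp_compl_def
    proof (intro conjI ballI allI)
      fix X Y :: "(real \<Rightarrow> 'a) set" and c :: 'a
      assume X: "X \<in> Lp_space p"
      then obtain f where f: "f \<in> Lp_fun p" "X = Lp_rel p `` {f}" using cls by blast
      show "T (Lp_scale p c X) = compl_scale p M c (T X)"
        using f by (simp add: T Lp_scale_class Lp_fun_cmult compl_scale_flat_approx)
      assume "Y \<in> Lp_space p"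
      then obtain g where g: "g \<in> Lp_fun p" "Y = Lp_rel p `` {g}" using cls by blast
      show "T (Lp_add p X Y) = compl_add p M (T X) (T Y)"
        using f g by (simp add: T Lp_add_class Lp_fun_add compl_add_flat_approx)
    qed
    show "continuous_Lp_compl p M T"
      unfolding continuous_Lp_compl_def
    proof (intro ballI allI impI)
      fix X :: "(real \<Rightarrow> 'a) set" and e :: real assume "X \<in> Lp_space p" and e: "0 < e"
      then obtain f where f: "f \<in> Lp_fun p" "X = Lp_rel p `` {f}" using cls by blast
      \<comment> \<open>Since \<open>M 0 \<ge> 1\<close>, the map does not increase distances, so
        \<open>e\<close> itself serves as \<open>\<delta>\<close>.\<close>
      have "compl_qnorm p M (compl_diff p M (T Y) (T X)) < ennreal e"
        if Y: "Y \<in> Lp_space p" and less: "Lp_qnorm p (Lp_diff p Y X) < ennreal e" for Y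
      proof -
        obtain g where g: "g \<in> Lp_fun p" "Y = Lp_rel p `` {g}" using cls Y by blast
        have "compl_qnorm p M (compl_diff p M (T Y) (T X)) = Lp_norm p (\<lambda>x. g x - f x) / ennreal (M 0)"
          using f g by (simp add: T compl_diff_flat_approx compl_qnorm_flat_approx Lp_fun_diff)
        also have "\<dots> \<le> Lp_norm p (\<lambda>x. g x - f x)" by (intro divide_ennreal_le_self M_ge_1)
        also have "\<dots> = Lp_qnorm p (Lp_diff p Y X)"
          using f g by (simp add: Lp_diff_class Lp_qnorm_class Lp_fun_diff)
        also note less
        finally show ?thesis .
      qed
      then show "\<exists>\<delta>>0. \<forall>Y\<in>Lp_space p. Lp_qnorm p (Lp_diff p Y X) < ennreal \<delta> \<longrightarrow>
          compl_qnorm p M (compl_diff p M (T Y) (T X)) < ennreal e"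
        using e by blast
    qed
    show "flat_approx p M f \<noteq> {}" if "f \<in> Lp_fun p" for f :: "real \<Rightarrow> 'a"
      using that by (rule flat_approx_nonempty)
    show "T (Lp_rel p `` {f}) = C_rel p M `` {F}" if "f \<in> Lp_fun p" "F \<in> flat_approx p M f" for f F
      using that by (simp add: T C_rel_flat_approx Lp_fun_measurable)
  qed
qed

end
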